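(* Let $L$ be a set of prime numbers such that at least one prime number does not belong to $L$, and let $M$ be a finite $L$-hypertournament. If $\varphi_1,\ldots,\varphi_n$ are partial automorphisms of $M$ with pairwise disjoint domains and pairwise disjoint ranges, then there is a finite $L$-hypertournament $M'$ containing $M$ as a substructure such that every $\varphi_i$ extends to an automorphism of $M'$.
   Context: For a set $L$ of natural numbers, an $L$-hypergraph is a relational structure with one relation symbol $R_l$ of arity $l$ for each $l\in L$. For a relation symbol $R$ of arity $l$ and $\sigma\in\mathrm{Sym}(\{1,\ldots,l\})$, write $R_\sigma(x_1,\ldots,x_l)$ iff $R(x_{\sigma(1)},\ldots,x_{\sigma(l)})$. A sequence of $l$-tuples of distinct elements is a cycle if it has the form $(x_1,x_2,\ldots,x_l),(x_2,\ldots,x_l,x_1),\ldots,(x_l,x_1,\ldots,x_{l-1})$. An $L$-hypergraph $M$ is an $L$-hypertournament if for every $l\in L$ and every $l$-tuple $\bar x$ of distinct elements of $M$ there is $\sigma\in\mathrm{Sym}(\{1,\ldots,l\})$ with $M\models (R_l)_\sigma(\bar x)$, and for no $l\in L$ and no permutation $\sigma$ is there a cycle $\bar x_1,\ldots,\bar x_l$ with $M\models (R_l)_\sigma(\bar x_i)$ for all $i\le l$. (A $\{2\}$-hypertournament is a tournament.) A partial automorphism (partial isomorphism) of $M$ is an isomorphism between two substructures of $M$. *)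

theory Defs
  imports
    "HOL-Computational_Algebra.Primes"
    "HOL-Combinatorics.Permutations"
    "HOL-Library.Disjoint_Sets"
begin

text \<open>
  Tuples are lists. The set of arities \<open>L\<close> is not part of the structure: it is a parameter of the
  notions below, and \<^term>\<open>rel M l\<close> is irrelevant for \<open>l \<notin> L\<close>. No constraint is put on the tuples
  with repeated entries that satisfy a relation.
\<close>

record 'a hypergraph =
  univ :: "'a set"
  rel :: "nat \<Rightarrow> 'a list set"

definition is_hypergraph :: "nat set \<Rightarrow> 'a hypergraph \<Rightarrow> bool" where
  "is_hypergraph L M \<longleftrightarrow>
    (\<forall>l\<in>L. rel M l \<subseteq> {xs. length xs = l \<and> set xs \<subseteq> univ M})"

text \<open>
  \<open>R\<^sub>\<sigma>\<close>, with the positions of an \<open>l\<close>-tuple numbered from \<open>0\<close>: the \<open>i\<close>-th entry of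
  \<^term>\<open>permute_list \<sigma> xs\<close> is \<^term>\<open>xs ! \<sigma> i\<close>.
\<close>

definition rel_perm :: "'a hypergraph \<Rightarrow> nat \<Rightarrow> (nat \<Rightarrow> nat) \<Rightarrow> 'a list \<Rightarrow> bool" where
  "rel_perm M l \<sigma> xs \<longleftrightarrow> permute_list \<sigma> xs \<in> rel M l"

definition is_cycle :: "'a set \<Rightarrow> nat \<Rightarrow> 'a list list \<Rightarrow> bool" where
  "is_cycle A l cs \<longleftrightarrow>
    (\<exists>xs. length xs = l \<and> set xs \<subseteq> A \<and> distinct xs \<and> cs = map (\<lambda>i. rotate i xs) [0..<l])"

definition hypertournament :: "nat set \<Rightarrow> 'a hypergraph \<Rightarrow> bool" where
  "hypertournament L M \<longleftrightarrow>
    is_hypergraph L M \<and>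
    (\<forall>l\<in>L. \<forall>xs. length xs = l \<and> set xs \<subseteq> univ M \<and> distinct xs \<longrightarrow>
      (\<exists>\<sigma>. \<sigma> permutes {..<l} \<and> rel_perm M l \<sigma> xs)) \<and>
    \<not> (\<exists>l\<in>L. \<exists>\<sigma>. \<sigma> permutes {..<l} \<and>
        (\<exists>cs. is_cycle (univ M) l cs \<and> (\<forall>xs\<in>set cs. rel_perm M l \<sigma> xs)))"

definition induced :: "'a hypergraph \<Rightarrow> 'a set \<Rightarrow> 'a hypergraph" where
  "induced M A = \<lparr>univ = A, rel = (\<lambda>l. {xs \<in> rel M l. set xs \<subseteq> A})\<rparr>"

definition substructure :: "nat set \<Rightarrow> 'a hypergraph \<Rightarrow> 'a hypergraph \<Rightarrow> bool" where
  "substructure L N M \<longleftrightarrow>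
    univ N \<subseteq> univ M \<and> (\<forall>l\<in>L. rel N l = rel (induced M (univ N)) l)"

definition is_iso :: "nat set \<Rightarrow> 'a hypergraph \<Rightarrow> 'b hypergraph \<Rightarrow> ('a \<Rightarrow> 'b) \<Rightarrow> bool" where
  "is_iso L M N f \<longleftrightarrow>
    bij_betw f (univ M) (univ N) \<and>
    (\<forall>l\<in>L. \<forall>xs. length xs = l \<and> set xs \<subseteq> univ M \<longrightarrow>
      (xs \<in> rel M l \<longleftrightarrow> map f xs \<in> rel N l))"

definition automorphism :: "nat set \<Rightarrow> 'a hypergraph \<Rightarrow> ('a \<Rightarrow> 'a) \<Rightarrow> bool" where
  "automorphism L M f \<longleftrightarrow> is_iso L M M f"

definition partial_automorphism :: "nat set \<Rightarrow> 'a hypergraph \<Rightarrow> ('a \<rightharpoonup> 'a) \<Rightarrow> bool" where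
  "partial_automorphism L M \<phi> \<longleftrightarrow>
    dom \<phi> \<subseteq> univ M \<and> ran \<phi> \<subseteq> univ M \<and>
    is_iso L (induced M (dom \<phi>)) (induced M (ran \<phi>)) (the \<circ> \<phi>)"

text \<open>
  The type \<open>'a\<close> of a structure may be too small to hold a given extension of it, so extensions
  are sought for the isomorphic copy of the structure in a larger type.
\<close>

definition map_hypergraph :: "('a \<Rightarrow> 'b) \<Rightarrow> 'a hypergraph \<Rightarrow> 'b hypergraph" where
  "map_hypergraph f M = \<lparr>univ = f ` univ M, rel = (\<lambda>l. map f ` rel M l)\<rparr>"

end

theory Submission
  imports
    "HOL-Algebra.Elementary_Groups"
    "HOL-Combinatorics.Cycles"
    Defs
begin

text \<open>
  Every colour-preserving injection of a finite set extends to a permutation, so the \<open>\<phi>\<^sub>i\<close> together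
  with finitely many one-point maps may be assumed to fit into one permutation \<open>\<pi>\<close> of \<open>M\<close>, each
  point \<open>x\<close> being labelled by the map that moves it. In a group \<open>G\<close> with one generator per label,
  let \<open>w(t, x)\<close> be the product of the labels of \<open>x, \<pi> x, \<dots>, \<pi>\<^sup>t\<^sup>-\<^sup>1 x\<close>, and let the points of \<open>M'\<close> be the
  classes of \<open>G \<times> M\<close> under \<open>(g, x) \<sim> (g w(t, x), \<pi>\<^sup>t x)\<close>. The group \<open>G\<close> acts from the left and its
  generators extend the \<open>\<phi>\<^sub>i\<close>. If the exponent of \<open>G\<close> is prime to \<open>L\<close>, no element of \<open>G\<close> induces an
  \<open>l\<close>-cycle, and relations can be chosen invariantly on the \<open>l\<close>-sets outside the translates of \<open>M\<close>.
  Inside the translates one needs that equal values \<open>w(t\<^sub>x, x) = \<gamma>\<close> for the entries \<open>x\<close> of a tuple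
  are explained by a common composition of the \<open>\<phi>\<^sub>i\<close>.

  This is achieved by an iterated wreath product. Products in \<open>H = \<int>\<^sub>q \<wr> \<int>\<^sub>q\<close> determine words of
  length up to \<open>q\<close>, which makes the walks \<open>w(t, x)\<close> in the Cayley graph of \<open>H\<close> run around simple
  cycles. Products in \<open>G = \<int>\<^sub>q \<wr> H\<close> moreover count modulo \<open>q\<close> how often each edge of that graph is
  traversed, and such a count determines the simple walk that produced it. The modulus \<open>q\<close> must be
  prime to \<open>L\<close>: a prime \<open>p \<notin> L\<close> makes it large, and its defect with respect to the order of \<open>\<pi>\<close>
  is harmless because partial automorphisms of a hypertournament have no \<open>l\<close>-cycles.
\<close>

section \<open>Words in wreath products\<close>

text \<open>
  Right multiplication by a generator \<open>i\<close> moves the cursor \<open>h\<close> along the edge \<open>(h, i)\<close> of the Cayley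
  graph and adds \<open>1\<close> to the lamp of that edge.
\<close>

definition wreath :: "('g, 'm) monoid_scheme \<Rightarrow> 'i set \<Rightarrow> nat \<Rightarrow> ('g \<times> ('g \<times> 'i \<Rightarrow> int)) monoid" where
  "wreath H I q =
    \<lparr>carrier = carrier H \<times> (carrier H \<times> I \<rightarrow>\<^sub>E {0..<int q}),
     monoid.mult = (\<lambda>(h, f) (h', f'). (h \<otimes>\<^bsub>H\<^esub> h',
       \<lambda>z\<in>carrier H \<times> I. (f z + f' (inv\<^bsub>H\<^esub> h \<otimes>\<^bsub>H\<^esub> fst z, snd z)) mod int q)),
     one = (\<one>\<^bsub>H\<^esub>, \<lambda>z\<in>carrier H \<times> I. 0)\<rparr>"

definition wreath_gen :: "('g, 'm) monoid_scheme \<Rightarrow> 'i set \<Rightarrow> ('i \<Rightarrow> 'g) \<Rightarrow> 'i \<Rightarrow> 'g \<times> ('g \<times> 'i \<Rightarrow> int)" where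
  "wreath_gen H I \<xi> i = (\<xi> i, \<lambda>z\<in>carrier H \<times> I. if z = (\<one>\<^bsub>H\<^esub>, i) then 1 else 0)"

definition word_prod :: "('g, 'm) monoid_scheme \<Rightarrow> ('i \<Rightarrow> 'g) \<Rightarrow> 'i list \<Rightarrow> 'g" where
  "word_prod G \<xi> ws = foldl (\<lambda>g i. g \<otimes>\<^bsub>G\<^esub> \<xi> i) \<one>\<^bsub>G\<^esub> ws"

lemma carrier_wreath: "carrier (wreath H I q) = carrier H \<times> (carrier H \<times> I \<rightarrow>\<^sub>E {0..<int q})"
  by (simp add: wreath_def)

lemma one_wreath: "\<one>\<^bsub>wreath H I q\<^esub> = (\<one>\<^bsub>H\<^esub>, \<lambda>z\<in>carrier H \<times> I. 0)"
  by (simp add: wreath_def)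

lemma mult_wreath: "(h, f) \<otimes>\<^bsub>wreath H I q\<^esub> (h', f') = (h \<otimes>\<^bsub>H\<^esub> h',
       \<lambda>z\<in>carrier H \<times> I. (f z + f' (inv\<^bsub>H\<^esub> h \<otimes>\<^bsub>H\<^esub> fst z, snd z)) mod int q)"
  by (simp add: wreath_def)

lemma group_wreath:
  assumes "group H" and "q > 0"
  shows "group (wreath H I q)"
proof -
  interpret H: group H by fact
  let ?W = "wreath H I q"
  show ?thesis
  proof (rule groupI)
    fix x y assume "x \<in> carrier ?W" "y \<in> carrier ?W"
    then show "x \<otimes>\<^bsub>?W\<^esub> y \<in> carrier ?W"
      using \<open>q > 0\<close> by (cases x; cases y) (auto simp: carrier_wreath mult_wreath)
  next
    show "\<one>\<^bsub>?W\<^esub> \<in> carrier ?W"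
      using \<open>q > 0\<close> by (auto simp: carrier_wreath one_wreath)
  next
    fix x y z assume "x \<in> carrier ?W" "y \<in> carrier ?W" "z \<in> carrier ?W"
    then show "x \<otimes>\<^bsub>?W\<^esub> y \<otimes>\<^bsub>?W\<^esub> z = x \<otimes>\<^bsub>?W\<^esub> (y \<otimes>\<^bsub>?W\<^esub> z)"
      by (cases x; cases y; cases z)
        (auto simp: carrier_wreath mult_wreath H.m_assoc H.inv_mult_group mod_simps add.assoc
          intro!: restrict_ext)
  next
    fix x assume x: "x \<in> carrier ?W"
    obtain h f where [simp]: "x = (h, f)" by fastforce
    have h: "h \<in> carrier H" and f: "f \<in> carrier H \<times> I \<rightarrow>\<^sub>E {0..<int q}"
      using x by (auto simp: carrier_wreath)
    have "(\<lambda>z\<in>carrier H \<times> I. ((\<lambda>z\<in>carrier H \<times> I. 0) z + f (inv\<^bsub>H\<^esub> \<one>\<^bsub>H\<^esub> \<otimes>\<^bsub>H\<^esub> fst z, snd z)) mod int q)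
        = restrict f (carrier H \<times> I)"
    proof (rule restrict_ext)
      fix z assume z: "z \<in> carrier H \<times> I"
      then show "((\<lambda>z\<in>carrier H \<times> I. 0) z + f (inv\<^bsub>H\<^esub> \<one>\<^bsub>H\<^esub> \<otimes>\<^bsub>H\<^esub> fst z, snd z)) mod int q = f z"
        using PiE_mem[OF f z] by auto
    qed
    also have "\<dots> = f" using f by (rule PiE_restrict)
    finally show "\<one>\<^bsub>?W\<^esub> \<otimes>\<^bsub>?W\<^esub> x = x"
      unfolding one_wreath \<open>x = (h, f)\<close> mult_wreath using h by (simp only: H.l_one)
    let ?f = "\<lambda>z\<in>carrier H \<times> I. (- f (h \<otimes>\<^bsub>H\<^esub> fst z, snd z)) mod int q"
    have "(inv\<^bsub>H\<^esub> h, ?f) \<in> carrier ?W"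
      using h \<open>q > 0\<close> by (auto simp: carrier_wreath)
    moreover have "(inv\<^bsub>H\<^esub> h, ?f) \<otimes>\<^bsub>?W\<^esub> x = \<one>\<^bsub>?W\<^esub>"
      using h by (auto simp: one_wreath mult_wreath mod_simps intro!: restrict_ext)
    ultimately show "\<exists>y\<in>carrier ?W. y \<otimes>\<^bsub>?W\<^esub> x = \<one>\<^bsub>?W\<^esub>" by blast
  qed
qed

lemma finite_wreath:
  assumes "finite (carrier H)" and "finite I"
  shows "finite (carrier (wreath H I q))"
  using assms by (simp add: carrier_wreath finite_PiE)

lemma wreath_gen_closed:
  assumes "\<xi> i \<in> carrier H" and "q > 1"
  shows "wreath_gen H I \<xi> i \<in> carrier (wreath H I q)"
  using assms by (auto simp: carrier_wreath wreath_gen_def)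

text \<open>The power with exponent \<open>e\<close> has trivial cursor, and elements with trivial
  cursor only add their lamps, which are counted modulo \<open>q\<close>.\<close>

lemma wreath_exponent:
  assumes "group H" and "q > 0" and e: "\<And>h. h \<in> carrier H \<Longrightarrow> h [^]\<^bsub>H\<^esub> (e::nat) = \<one>\<^bsub>H\<^esub>"
    and x: "x \<in> carrier (wreath H I q)"
  shows "x [^]\<^bsub>wreath H I q\<^esub> (e * q) = \<one>\<^bsub>wreath H I q\<^esub>"
proof -
  interpret H: group H by fact
  interpret W: group "wreath H I q" using assms by (intro group_wreath)
  have fst_pow: "fst (y [^]\<^bsub>wreath H I q\<^esub> n) = fst y [^]\<^bsub>H\<^esub> n" for y and n :: nat
    by (induction n) (auto simp: one_wreath mult_wreath case_prod_beta wreath_def)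
  define y where "y = x [^]\<^bsub>wreath H I q\<^esub> e"
  have y: "y \<in> carrier (wreath H I q)" using x by (simp add: y_def)
  have "fst y = \<one>\<^bsub>H\<^esub>" using x e by (auto simp: y_def fst_pow carrier_wreath)
  then obtain f where yf: "y = (\<one>\<^bsub>H\<^esub>, f)" by (cases y) auto
  have "y [^]\<^bsub>wreath H I q\<^esub> n = (\<one>\<^bsub>H\<^esub>, \<lambda>z\<in>carrier H \<times> I. (int n * f z) mod int q)" for n :: nat
  proof (induction n)
    case 0
    then show ?case by (auto simp: one_wreath)
  next
    case (Suc n)
    have "y [^]\<^bsub>wreath H I q\<^esub> Suc n = (\<one>\<^bsub>H\<^esub>, \<lambda>z\<in>carrier H \<times> I. (int n * f z) mod int q) \<otimes>\<^bsub>wreath H I q\<^esub> (\<one>\<^bsub>H\<^esub>, f)"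
      by (simp only: nat_pow_Suc Suc) (simp only: yf)
    also have "\<dots> = (\<one>\<^bsub>H\<^esub>, \<lambda>z\<in>carrier H \<times> I. (int (Suc n) * f z) mod int q)"
      by (auto simp: mult_wreath mod_simps algebra_simps intro!: restrict_ext)
    finally show ?case .
  qed
  then have "y [^]\<^bsub>wreath H I q\<^esub> q = \<one>\<^bsub>wreath H I q\<^esub>" by (simp add: one_wreath)
  then show ?thesis using x by (simp add: y_def W.nat_pow_pow)
qed

section \<open>Words as walks and their edge counts\<close>

lemma word_prod_Nil [simp]: "word_prod G \<xi> [] = \<one>\<^bsub>G\<^esub>"
  by (simp add: word_prod_def)

lemma word_prod_snoc [simp]: "word_prod G \<xi> (ws @ [i]) = word_prod G \<xi> ws \<otimes>\<^bsub>G\<^esub> \<xi> i"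
  by (simp add: word_prod_def)

lemma (in monoid) word_prod_closed [simp, intro]:
  assumes "\<xi> ` I \<subseteq> carrier G" and "set ws \<subseteq> I"
  shows "word_prod G \<xi> ws \<in> carrier G"
  using assms(2) by (induction ws rule: rev_induct) (use assms(1) in auto)

lemma (in monoid) word_prod_append:
  assumes "\<xi> ` I \<subseteq> carrier G" and "set ws \<subseteq> I" and "set vs \<subseteq> I"
  shows "word_prod G \<xi> (ws @ vs) = word_prod G \<xi> ws \<otimes> word_prod G \<xi> vs"
  using assms(3)
proof (induction vs rule: rev_induct)
  case Nil
  then show ?case using assms by auto
next
  case (snoc v vs)
  then have "word_prod G \<xi> ws \<in> carrier G" "word_prod G \<xi> vs \<in> carrier G" "\<xi> v \<in> carrier G"
    using assms by auto
  then show ?case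
    using snoc by (simp add: m_assoc flip: append_assoc)
qed

text \<open>The word spells a walk from the identity in the Cayley graph of \<open>H\<close>, and
  the lamps count traversals of edges. An appended letter adds one traversal of the edge that leaves
  the current vertex with this letter.\<close>

lemma word_prod_wreath:
  assumes "group H" and "q > 1" and \<xi>: "\<xi> ` I \<subseteq> carrier H" and "set ws \<subseteq> I"
  shows "word_prod (wreath H I q) (wreath_gen H I \<xi>) ws =
    (word_prod H \<xi> ws, \<lambda>z\<in>carrier H \<times> I.
      int (card {s. s < length ws \<and> word_prod H \<xi> (take s ws) = fst z \<and> ws ! s = snd z}) mod int q)"
  using assms(4)
proof (induction ws rule: rev_induct)
  case Nil
  then show ?case by (auto simp: one_wreath)
next
  interpret H: group H by fact
  case (snoc i ws)
  have i: "i \<in> I" and ws: "set ws \<subseteq> I" using snoc by auto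
  let ?A = "\<lambda>ws z. {s. s < length ws \<and> word_prod H \<xi> (take s ws) = fst z \<and> ws ! s = snd z}"
  have h: "word_prod H \<xi> ws \<in> carrier H" using ws \<xi> by blast
  have count: "card (?A (ws @ [i]) z) = card (?A ws z) + (if z = (word_prod H \<xi> ws, i) then 1 else 0)" for z
  proof -
    have "?A (ws @ [i]) z = ?A ws z \<union> (if z = (word_prod H \<xi> ws, i) then {length ws} else {})"
      by (auto simp: nth_append less_Suc_eq prod_eq_iff)
    then show ?thesis by simp
  qed
  have eq: "inv\<^bsub>H\<^esub> word_prod H \<xi> ws \<otimes>\<^bsub>H\<^esub> k = \<one>\<^bsub>H\<^esub> \<longleftrightarrow> k = word_prod H \<xi> ws" if "k \<in> carrier H" for k
    using h that by (metis H.inv_closed H.inv_equality H.inv_inv H.l_inv)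
  have "word_prod (wreath H I q) (wreath_gen H I \<xi>) (ws @ [i]) =
      (word_prod H \<xi> ws, \<lambda>z\<in>carrier H \<times> I. int (card (?A ws z)) mod int q) \<otimes>\<^bsub>wreath H I q\<^esub>
      (\<xi> i, \<lambda>z\<in>carrier H \<times> I. if z = (\<one>\<^bsub>H\<^esub>, i) then 1 else 0)"
    by (simp only: word_prod_snoc snoc.IH[OF ws] wreath_gen_def)
  also have "\<dots> = (word_prod H \<xi> (ws @ [i]), \<lambda>z\<in>carrier H \<times> I. int (card (?A (ws @ [i]) z)) mod int q)"
    unfolding mult_wreath count word_prod_snoc
    using h eq by (intro arg_cong2[where f = Pair] refl restrict_ext) (auto simp: mod_simps)
  finally show ?case .
qed

lemma word_prod_integer_mod_group:
  assumes "q > 1"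
  shows "word_prod (integer_mod_group q) (\<lambda>i. 1) ws = int (length ws) mod int q"
  by (induction ws rule: rev_induct)
    (use assms in \<open>auto simp: integer_mod_group_def add_ac mod_simps\<close>)

text \<open>Every generator is \<open>1\<close> in the cyclic group, so the cursor is at
  \<open>s\<close> when letter number \<open>s < q\<close> is read. No vertex is left twice, and the
  lamps at \<open>s\<close> show which letter was read there.\<close>

lemma word_prod_wreath_inject:
  assumes q: "q > 1" and "set ws \<subseteq> I" and "set vs \<subseteq> I" and len: "length ws = length vs" "length vs \<le> q"
    and eq: "word_prod (wreath (integer_mod_group q) I q) (wreath_gen (integer_mod_group q) I (\<lambda>i. 1)) ws
      = word_prod (wreath (integer_mod_group q) I q) (wreath_gen (integer_mod_group q) I (\<lambda>i. 1)) vs"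
  shows "ws = vs"
proof -
  let ?Z = "integer_mod_group q" and ?\<xi> = "\<lambda>i. 1"
  have car: "carrier ?Z = {0..<int q}" using q by (simp add: carrier_integer_mod_group)
  have \<xi>: "?\<xi> ` I \<subseteq> carrier ?Z" using q by (auto simp: car)
  have count: "snd (word_prod (wreath ?Z I q) (wreath_gen ?Z I ?\<xi>) us) (int s, i) = (if us ! s = i then 1 else 0)"
    if us: "set us \<subseteq> I" "length us \<le> q" and s: "s < length us" and i: "i \<in> I" for us s i
  proof -
    have "{t. t < length us \<and> word_prod ?Z ?\<xi> (take t us) = int s \<and> us ! t = i} = (if us ! s = i then {s} else {})"
      using s us(2) q by (auto simp: word_prod_integer_mod_group)
    then show ?thesis
      using s us i q by (simp add: word_prod_wreath[OF group_integer_mod_group q \<xi>] car)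
  qed
  show ?thesis
  proof (rule nth_equalityI)
    fix s assume s: "s < length ws"
    then have "ws ! s \<in> I" using assms by auto
    then show "ws ! s = vs ! s"
      using count[of ws s "ws ! s"] count[of vs s "ws ! s"] s assms by (simp split: if_splits)
  qed (fact len)
qed

section \<open>Invariant hypertournaments\<close>

lemma permute_list_inject:
  assumes "\<sigma> permutes {..<length xs}" and "length xs = length ys"
    and "permute_list \<sigma> xs = permute_list \<sigma> ys"
  shows "xs = ys"
proof (rule nth_equalityI)
  fix i assume i: "i < length xs"
  obtain j where "j < length xs" "\<sigma> j = i"
    using permutes_image[OF assms(1)] i by (metis imageE lessThan_iff)
  then show "xs ! i = ys ! i"
    using assms by (metis permute_list_nth)
qed (fact assms(2))

lemma hypertournament_no_rotation:
  assumes "hypertournament L M" and "l \<in> L" and "\<sigma> permutes {..<l}"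
    and "length xs = l" and "set xs \<subseteq> univ M" and "distinct xs"
    and "\<And>i. i < l \<Longrightarrow> permute_list \<sigma> (rotate i xs) \<in> rel M l"
  shows False
proof -
  have "is_cycle (univ M) l (map (\<lambda>i. rotate i xs) [0..<l])"
    using assms unfolding is_cycle_def by blast
  moreover have "\<forall>ys\<in>set (map (\<lambda>i. rotate i xs) [0..<l]). rel_perm M l \<sigma> ys"
    using assms by (auto simp: rel_perm_def)
  ultimately show False
    using assms(1-3) unfolding hypertournament_def by blast
qed

lemma subset_image_map:
  assumes "set xs \<subseteq> f ` A"
  obtains zs where "xs = map f zs" and "set zs \<subseteq> A"
proof -
  have "xs \<in> map f ` lists A" using assms by (simp flip: lists_image add: in_lists_conv_set subset_iff)
  then show thesis using that by auto
qed

text \<open>The exponent conditions exclude group elements that rotate a tuple of distinct entries.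
  The condition \<open>consistent\<close> ensures that overlapping translates of \<open>M\<close>
  impose the same relations on their common tuples.\<close>

locale tournament_cover = group G for G :: "('g, 'm) monoid_scheme" (structure) +
  fixes L :: "nat set" and M :: "'a hypergraph" and X :: "'c set"
    and act :: "'g \<Rightarrow> 'c \<Rightarrow> 'c" and e :: "'a \<Rightarrow> 'c" and E :: nat
  assumes prime_L: "l \<in> L \<Longrightarrow> prime l"
    and tournament: "hypertournament L M"
    and act_closed: "g \<in> carrier G \<Longrightarrow> x \<in> X \<Longrightarrow> act g x \<in> X"
    and act_one: "x \<in> X \<Longrightarrow> act \<one> x = x"
    and act_mult: "g \<in> carrier G \<Longrightarrow> h \<in> carrier G \<Longrightarrow> x \<in> X \<Longrightarrow> act (g \<otimes> h) x = act g (act h x)"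
    and exponent: "g \<in> carrier G \<Longrightarrow> g [^] E = \<one>"
    and coprime_exponent: "l \<in> L \<Longrightarrow> \<not> l dvd E"
    and e_closed: "e ` univ M \<subseteq> X"
    and inj_e: "inj_on e (univ M)"
    and consistent: "g \<in> carrier G \<Longrightarrow> length xs \<in> L \<Longrightarrow>
      (\<And>x. x \<in> set xs \<Longrightarrow> x \<in> univ M \<and> f x \<in> univ M \<and> act g (e x) = e (f x)) \<Longrightarrow>
      xs \<in> rel M (length xs) \<longleftrightarrow> map f xs \<in> rel M (length xs)"
begin

text \<open>On these sets the relations are dictated by \<open>M\<close>; on all others they may be
  chosen, subject to invariance.\<close>

definition live :: "'c set \<Rightarrow> bool" where
  "live S \<longleftrightarrow> (\<exists>g\<in>carrier G. S \<subseteq> act g ` e ` univ M)"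

definition set_orbit :: "'c set \<Rightarrow> 'c set set" where
  "set_orbit S = (\<lambda>g. act g ` S) ` carrier G"

text \<open>
  A set outside all translates of the image of \<open>M\<close> receives the translates of one enumeration,
  which is chosen for its orbit and not for the set itself.
\<close>

definition orbit_rep :: "'c set \<Rightarrow> 'c list" where
  "orbit_rep S = (SOME zs. distinct zs \<and> set zs \<in> set_orbit S)"

text \<open>A set that is not live can receive several enumerations of itself; they differ by
  elements of \<open>G\<close> that stabilise the set.\<close>

definition cover :: "'c hypergraph" where
  "cover = \<lparr>univ = X, rel = (\<lambda>l.
      {map (act g \<circ> e) zs |g zs. g \<in> carrier G \<and> zs \<in> rel M l \<and> set zs \<subseteq> univ M} \<union>
      {map (act g) (orbit_rep (set xs)) |g xs. g \<in> carrier G \<and> distinct xs \<and> length xs = l \<and>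
        set xs \<subseteq> X \<and> \<not> live (set xs)})\<rparr>"

lemma univ_cover [simp]: "univ cover = X"
  by (simp add: cover_def)

lemma act_inv:
  assumes "g \<in> carrier G" and "x \<in> X"
  shows "act (inv g) (act g x) = x" and "act g (act (inv g) x) = x"
  using assms act_mult[of "inv g" g x] act_mult[of g "inv g" x] act_one by simp_all

lemma inj_act: "g \<in> carrier G \<Longrightarrow> inj_on (act g) X"
  by (metis act_inv(1) inj_onI)

lemma bij_act: "g \<in> carrier G \<Longrightarrow> bij_betw (act g) X X"
  by (rule bij_betw_byWitness[where f' = "act (inv g)"]) (auto simp: act_inv act_closed)

lemma act_image_mult:
  assumes "g \<in> carrier G" and "h \<in> carrier G" and "S \<subseteq> X"
  shows "act (g \<otimes> h) ` S = act g ` act h ` S"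
  using assms by (force simp: act_mult image_image intro!: image_cong)

lemma act_image_inv:
  assumes "g \<in> carrier G" and "S \<subseteq> X"
  shows "act (inv g) ` act g ` S = S"
  using assms by (force simp: act_inv image_image subset_iff)

lemma set_orbit_act:
  assumes g: "g \<in> carrier G" and S: "S \<subseteq> X"
  shows "set_orbit (act g ` S) = set_orbit S"
proof -
  have *: "set_orbit (act h ` T) \<subseteq> set_orbit T" if "h \<in> carrier G" "T \<subseteq> X" for h T
    using that by (auto simp: set_orbit_def simp flip: act_image_mult)
  have "act g ` S \<subseteq> X" using g S act_closed by blast
  then show ?thesis
    using *[OF g S] *[of "inv g" "act g ` S"] g S by (simp add: act_image_inv)
qed

lemma live_act:
  assumes g: "g \<in> carrier G" and S: "S \<subseteq> X" and "live (act g ` S)"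
  shows "live S"
proof -
  obtain h where h: "h \<in> carrier G" "act g ` S \<subseteq> act h ` e ` univ M"
    using assms unfolding live_def by blast
  then have "act (inv g) ` act g ` S \<subseteq> act (inv g) ` act h ` e ` univ M" by blast
  then have "S \<subseteq> act (inv g \<otimes> h) ` e ` univ M"
    using g S h e_closed by (simp add: act_image_inv act_image_mult)
  then show ?thesis using g h unfolding live_def by blast
qed

lemma orbit_rep:
  assumes "distinct xs" and "set xs \<subseteq> X"
  obtains g where "g \<in> carrier G" and "set (orbit_rep (set xs)) = act g ` set xs"
    and "distinct (orbit_rep (set xs))" and "length (orbit_rep (set xs)) = length xs"
proof -
  have "act \<one> ` set xs = set xs"
    using assms act_one by (force simp: subset_iff)
  then have "distinct xs \<and> set xs \<in> set_orbit (set xs)"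
    using assms one_closed unfolding set_orbit_def by (metis imageI)
  then have rep: "distinct (orbit_rep (set xs)) \<and> set (orbit_rep (set xs)) \<in> set_orbit (set xs)"
    unfolding orbit_rep_def by (rule someI)
  then obtain g where g: "g \<in> carrier G" "set (orbit_rep (set xs)) = act g ` set xs"
    unfolding set_orbit_def by blast
  have "card (act g ` set xs) = card (set xs)"
    using g assms inj_act by (meson card_image inj_on_subset)
  then show thesis
    using that g rep assms by (metis distinct_card)
qed

text \<open>A tuple may lie in several translates of \<open>M\<close>. If it is related because of
  the translate by \<open>h\<close>, then \<open>inv h \<otimes> g\<close> carries one preimage in
  \<open>M\<close> to the other, and \<open>consistent\<close> compares them. The freely chosen
  tuples do not interfere, as their entry sets are not live.\<close>

lemma rel_cover_live:
  assumes g: "g \<in> carrier G" and zs: "set zs \<subseteq> univ M" and l: "length zs \<in> L"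
  shows "map (act g \<circ> e) zs \<in> rel cover (length zs) \<longleftrightarrow> zs \<in> rel M (length zs)"
proof
  assume "zs \<in> rel M (length zs)"
  then show "map (act g \<circ> e) zs \<in> rel cover (length zs)"
    using g zs by (auto simp: cover_def)
next
  let ?ws = "map (act g \<circ> e) zs"
  assume "?ws \<in> rel cover (length zs)"
  then consider (old) h zs' where "?ws = map (act h \<circ> e) zs'" "h \<in> carrier G" "zs' \<in> rel M (length zs)" "set zs' \<subseteq> univ M"
    | (new) h xs where "?ws = map (act h) (orbit_rep (set xs))" "h \<in> carrier G" "distinct xs"
       "set xs \<subseteq> X" "\<not> live (set xs)"
    unfolding cover_def by auto
  then show "zs \<in> rel M (length zs)"
  proof cases
    case old
    define k where "k = inv h \<otimes> g"
    \<comment> \<open>The motion by \<open>k\<close>, read off inside \<open>M\<close>; it is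
      meaningful at the entries of \<open>zs\<close>.\<close>
    define f where "f = inv_into (univ M) e \<circ> act k \<circ> e"
    have k: "k \<in> carrier G" using g old by (simp add: k_def)
    have len: "length zs = length zs'" using old(1) by (metis length_map)
    have f: "act k (e (zs ! i)) = e (zs' ! i) \<and> f (zs ! i) = zs' ! i" if i: "i < length zs" for i
    proof -
      have M: "zs ! i \<in> univ M" "zs' ! i \<in> univ M" using i zs old(4) len by (metis nth_mem subsetD)+
      then have X: "e (zs ! i) \<in> X" "e (zs' ! i) \<in> X" using e_closed by blast+
      have "act g (e (zs ! i)) = act h (e (zs' ! i))"
        using arg_cong[OF old(1), of "\<lambda>ws. ws ! i"] i len by simp
      then have "act k (e (zs ! i)) = e (zs' ! i)"
        using g old X by (simp add: k_def act_mult act_inv)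
      then show ?thesis using M inj_e by (simp add: f_def)
    qed
    have "zs \<in> rel M (length zs) \<longleftrightarrow> map f zs \<in> rel M (length zs)"
    proof (rule consistent[OF k l])
      fix x assume "x \<in> set zs"
      then obtain i where i: "i < length zs" "x = zs ! i" by (metis in_set_conv_nth)
      then show "x \<in> univ M \<and> f x \<in> univ M \<and> act k (e x) = e (f x)"
        using f[of i] zs old(4) len by (metis nth_mem subsetD)
    qed
    moreover have "map f zs = zs'" using f len by (auto intro: nth_equalityI)
    ultimately show ?thesis using old by simp
  next
    case new
    obtain k where k: "k \<in> carrier G" "set (orbit_rep (set xs)) = act k ` set xs"
      using orbit_rep new by metis
    have "set ?ws = act (h \<otimes> k) ` set xs"
      using new k by (simp only: list.set_map act_image_mult)
    moreover have "set ?ws \<subseteq> act g ` e ` univ M" using zs by auto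
    ultimately have "live (act (h \<otimes> k) ` set xs)" using g unfolding live_def by metis
    then show ?thesis using live_act new k by blast
  qed
qed

text \<open>The entry set of a chosen tuple is a translate of the set it was chosen for; both have
  the same orbit, hence the same \<open>orbit_rep\<close>.\<close>

lemma rel_cover_not_live:
  assumes "ws \<in> rel cover l" and "\<not> live (set ws)"
  obtains g where "g \<in> carrier G" and "ws = map (act g) (orbit_rep (set ws))"
proof -
  have "set (map (act g \<circ> e) zs) \<subseteq> act g ` e ` univ M" if "set zs \<subseteq> univ M" for g zs
    using that by auto
  then obtain h xs where h: "ws = map (act h) (orbit_rep (set xs))" "h \<in> carrier G" "distinct xs" "set xs \<subseteq> X"
    using assms unfolding cover_def live_def by auto metis
  obtain k where k: "k \<in> carrier G" "set (orbit_rep (set xs)) = act k ` set xs"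
    using orbit_rep h by metis
  have "set ws = act (h \<otimes> k) ` set xs"
    using h k by (simp only: list.set_map act_image_mult)
  then have "orbit_rep (set ws) = orbit_rep (set xs)"
    using h k by (simp add: orbit_rep_def set_orbit_act)
  then show thesis using that h by metis
qed

lemma rel_cover_subset:
  assumes "l \<in> L" and "ws \<in> rel cover l"
  shows "length ws = l \<and> set ws \<subseteq> X"
proof -
  have M: "length zs = l" if "zs \<in> rel M l" for zs
    using that assms(1) tournament unfolding hypertournament_def is_hypergraph_def by blast
  show ?thesis
    using assms(2) e_closed M unfolding cover_def
    by (auto simp: act_closed subset_iff elim: orbit_rep) (metis orbit_rep act_closed image_iff subsetI)+
qed

lemma rel_cover_new:
  assumes "g \<in> carrier G" and "distinct xs" and "set xs \<subseteq> X" and "\<not> live (set xs)"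
  shows "map (act g) (orbit_rep (set xs)) \<in> rel cover (length xs)"
  using assms unfolding cover_def by auto

lemma rel_cover_act:
  assumes g: "g \<in> carrier G" and ws: "ws \<in> rel cover l"
  shows "map (act g) ws \<in> rel cover l"
proof -
  consider (old) h zs where "ws = map (act h \<circ> e) zs" "h \<in> carrier G" "zs \<in> rel M l" "set zs \<subseteq> univ M"
    | (new) h xs where "ws = map (act h) (orbit_rep (set xs))" "h \<in> carrier G" "distinct xs"
       "length xs = l" "set xs \<subseteq> X" "\<not> live (set xs)"
    using ws unfolding cover_def by auto
  then show ?thesis
  proof cases
    case old
    then have "map (act g) ws = map (act (g \<otimes> h) \<circ> e) zs"
      using g e_closed by (auto simp: act_mult image_subset_iff)
    moreover have "g \<otimes> h \<in> carrier G" using old g by simp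
    ultimately show ?thesis using old unfolding cover_def by fastforce
  next
    case new
    have "set (orbit_rep (set xs)) \<subseteq> X"
      using orbit_rep[OF new(3,5)] new(5) act_closed by (metis image_subset_iff subsetD)
    then have "map (act g) ws = map (act (g \<otimes> h)) (orbit_rep (set xs))"
      using new g by (auto simp: act_mult)
    then show ?thesis using new g rel_cover_new[of "g \<otimes> h" xs] by (metis m_closed)
  qed
qed

lemma automorphism_act:
  assumes g: "g \<in> carrier G"
  shows "automorphism L cover (act g)"
proof -
  have "xs \<in> rel cover l" if "map (act g) xs \<in> rel cover l" "set xs \<subseteq> X" for xs l
  proof -
    have "map (act (inv g)) (map (act g) xs) = xs"
      using g that(2) by (simp add: act_inv subset_iff map_idI)
    then show ?thesis using rel_cover_act[OF inv_closed[OF g] that(1)] by simp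
  qed
  then show ?thesis
    using g by (auto simp: automorphism_def Defs.is_iso_def bij_act rel_cover_act)
qed

lemma substructure_cover: "substructure L (map_hypergraph e M) cover"
proof -
  have "map e ` rel M l = {xs \<in> rel cover l. set xs \<subseteq> e ` univ M}" if l: "l \<in> L" for l
  proof -
    have M: "length zs = l \<and> set zs \<subseteq> univ M" if "zs \<in> rel M l" for zs
      using that l tournament unfolding hypertournament_def is_hypergraph_def by blast
    have one: "map e zs = map (act \<one> \<circ> e) zs" if "set zs \<subseteq> univ M" for zs
      using that e_closed by (auto simp: act_one image_subset_iff subset_iff)
    have *: "map e zs \<in> rel cover l \<longleftrightarrow> zs \<in> rel M l" if "set zs \<subseteq> univ M" "length zs = l" for zs
      using rel_cover_live[of \<one> zs] one[of zs] that l by (metis one_closed)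
    show "map e ` rel M l = {xs \<in> rel cover l. set xs \<subseteq> e ` univ M}"
    proof (intro equalityI subsetI)
      fix xs assume "xs \<in> map e ` rel M l"
      then show "xs \<in> {xs \<in> rel cover l. set xs \<subseteq> e ` univ M}" using M * by fastforce
    next
      fix xs assume xs: "xs \<in> {xs \<in> rel cover l. set xs \<subseteq> e ` univ M}"
      then obtain zs where "xs = map e zs" "set zs \<subseteq> univ M"
        using subset_image_map[of xs e "univ M"] by blast
      then show "xs \<in> map e ` rel M l"
        using xs * rel_cover_subset[OF l, of xs] by simp
    qed
  qed
  then show ?thesis
    using e_closed by (auto simp: substructure_def map_hypergraph_def induced_def)
qed

text \<open>Otherwise the powers of \<open>g\<close> would rotate by as many places, and the trivial
  power with exponent \<open>E\<close> would rotate by \<open>E\<close> places. The entries being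
  distinct, the length would divide \<open>E\<close>.\<close>

lemma no_rotation_act:
  assumes g: "g \<in> carrier G" and xs: "distinct xs" "set xs \<subseteq> X" "length xs \<in> L"
  shows "map (act g) xs \<noteq> rotate1 xs"
proof
  assume rot: "map (act g) xs = rotate1 xs"
  have "map (act (g [^] n)) xs = rotate n xs" for n :: nat
  proof (induction n)
    case 0
    then show ?case using xs by (simp add: act_one subset_iff map_idI)
  next
    case (Suc n)
    have "map (act (g [^] Suc n)) xs = map (act (g [^] n)) (map (act g) xs)"
      using g xs by (auto simp: act_mult)
    also have "\<dots> = rotate1 (map (act (g [^] n)) xs)" by (simp add: rot rotate1_map)
    finally show ?case using Suc by simp
  qed
  from this[of E] have "rotate E xs = xs"
    using g xs by (simp add: exponent act_one subset_iff map_idI)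
  moreover have pos: "length xs > 0" using prime_L[OF xs(3)] prime_gt_0_nat by blast
  ultimately have "xs ! (E mod length xs) = xs ! 0"
    by (metis add.right_neutral nth_rotate)
  then have "E mod length xs = 0"
    using xs(1) pos by (metis mod_less_divisor nth_eq_iff_index_eq)
  then show False using coprime_exponent[OF xs(3)] by auto
qed

text \<open>Live tuples inherit both axioms from \<open>M\<close>. On any other set, the
  representative translated back gives an enumeration, and a cycle would yield a group element that
  rotates a tuple.\<close>

lemma hypertournament_cover: "hypertournament L cover"
  unfolding hypertournament_def
proof (intro conjI ballI allI impI notI)
  show "is_hypergraph L cover"
    using rel_cover_subset unfolding is_hypergraph_def by auto
next
  fix l xs assume l: "l \<in> L" and "length xs = l \<and> set xs \<subseteq> univ cover \<and> distinct xs"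
  then have xs: "length xs = l" "set xs \<subseteq> X" "distinct xs" by auto
  show "\<exists>\<sigma>. \<sigma> permutes {..<l} \<and> rel_perm cover l \<sigma> xs"
  proof (cases "live (set xs)")
    case True
    then obtain g where g: "g \<in> carrier G" "set xs \<subseteq> (act g \<circ> e) ` univ M"
      unfolding live_def image_comp by blast
    then obtain zs where zs: "xs = map (act g \<circ> e) zs" "set zs \<subseteq> univ M"
      using subset_image_map by meson
    then have "distinct zs" "length zs = l" using xs by (auto simp: distinct_map)
    then obtain \<sigma> where \<sigma>: "\<sigma> permutes {..<l}" "permute_list \<sigma> zs \<in> rel M l"
      using tournament l zs unfolding hypertournament_def rel_perm_def by blast
    have "permute_list \<sigma> xs \<in> rel cover l"
      using rel_cover_live[of g "permute_list \<sigma> zs"] \<sigma> zs g \<open>length zs = l\<close> l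
      by (simp add: permute_list_map)
    then show ?thesis using \<sigma> unfolding rel_perm_def by blast
  next
    case False
    obtain g where g: "g \<in> carrier G" "set (orbit_rep (set xs)) = act g ` set xs"
      "distinct (orbit_rep (set xs))" "length (orbit_rep (set xs)) = l"
      using orbit_rep xs by metis
    define ys where "ys = map (act (inv g)) (orbit_rep (set xs))"
    have ys: "ys \<in> rel cover l" using False xs g rel_cover_new[of "inv g" xs] by (simp add: ys_def)
    have "set ys = set xs" using g xs by (simp add: ys_def act_image_inv)
    moreover have "length ys = l" using g by (simp add: ys_def)
    ultimately have "distinct ys" using xs by (metis card_distinct distinct_card)
    then have "mset ys = mset xs" using xs \<open>set ys = set xs\<close> by (simp add: set_eq_iff_mset_eq_distinct)
    then obtain \<sigma> where "\<sigma> permutes {..<length xs}" "permute_list \<sigma> xs = ys"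
      by (rule mset_eq_permutation)
    then show ?thesis using ys xs unfolding rel_perm_def by auto
  qed
next
  assume "\<exists>l\<in>L. \<exists>\<sigma>. \<sigma> permutes {..<l} \<and>
      (\<exists>cs. is_cycle (univ cover) l cs \<and> (\<forall>xs\<in>set cs. rel_perm cover l \<sigma> xs))"
  then obtain l \<sigma> xs where l: "l \<in> L" and \<sigma>: "\<sigma> permutes {..<l}"
    and xs: "length xs = l" "set xs \<subseteq> X" "distinct xs"
    and "\<forall>ys\<in>set (map (\<lambda>i. rotate i xs) [0..<l]). permute_list \<sigma> ys \<in> rel cover l"
    unfolding is_cycle_def rel_perm_def by auto
  then have cyc: "permute_list \<sigma> (rotate i xs) \<in> rel cover l" if "i < l" for i
    using that by auto
  show False
  proof (cases "live (set xs)")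
    case True
    then obtain g where g: "g \<in> carrier G" "set xs \<subseteq> (act g \<circ> e) ` univ M"
      unfolding live_def image_comp by blast
    then obtain zs where zs: "xs = map (act g \<circ> e) zs" "set zs \<subseteq> univ M"
      using subset_image_map by meson
    then have "distinct zs" "length zs = l" using xs by (auto simp: distinct_map)
    moreover have "permute_list \<sigma> (rotate i zs) \<in> rel M l" if i: "i < l" for i
      using rel_cover_live[of g "permute_list \<sigma> (rotate i zs)"] cyc[OF i] zs g \<open>length zs = l\<close> l \<sigma>
      by (simp add: permute_list_map rotate_map)
    ultimately show False
      using hypertournament_no_rotation[OF tournament l \<sigma>] zs by metis
  next
    case False
    have rep: "\<exists>g\<in>carrier G. permute_list \<sigma> (rotate i xs) = map (act g) (orbit_rep (set xs))" if "i < l" for i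
      using rel_cover_not_live[OF cyc[OF that]] False xs \<sigma> by (metis length_rotate set_permute_list set_rotate)
    have "1 < l" using prime_L[OF l] prime_gt_1_nat by blast
    \<comment> \<open>Two successive tuples of the cycle suffice: they are translates of the same
      representative, so \<open>g1 \<otimes> inv g0\<close> takes one to the other.\<close>
    then obtain g0 g1 where g: "g0 \<in> carrier G" "g1 \<in> carrier G"
      "permute_list \<sigma> (rotate 0 xs) = map (act g0) (orbit_rep (set xs))"
      "permute_list \<sigma> (rotate 1 xs) = map (act g1) (orbit_rep (set xs))"
      using rep[of 0] rep[of 1] by auto
    have X: "set (orbit_rep (set xs)) \<subseteq> X"
      using orbit_rep[OF xs(3,2)] xs(2) act_closed by (metis image_subset_iff subsetD)
    have "permute_list \<sigma> (map (act (g1 \<otimes> inv g0)) xs) = map (act (g1 \<otimes> inv g0)) (permute_list \<sigma> (rotate 0 xs))"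
      using \<sigma> xs by (simp add: permute_list_map)
    also have "\<dots> = map (act (g1 \<otimes> inv g0)) (map (act g0) (orbit_rep (set xs)))"
      by (simp only: g(3))
    also have "\<dots> = map (act g1) (orbit_rep (set xs))"
      using g(1,2) X by (auto simp: act_mult act_closed act_inv subset_iff)
    also have "\<dots> = permute_list \<sigma> (rotate1 xs)"
      using g(4) by simp
    finally have "permute_list \<sigma> (map (act (g1 \<otimes> inv g0)) xs) = permute_list \<sigma> (rotate1 xs)" .
    then have "map (act (g1 \<otimes> inv g0)) xs = rotate1 xs"
      by (rule permute_list_inject[rotated 2]) (use \<sigma> xs in simp_all)
    then show False using no_rotation_act[of "g1 \<otimes> inv g0" xs] g(1,2) xs l by simp
  qed
qed

end

section \<open>Walks in the Cayley graph\<close>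

text \<open>These are the \<open>s = j * r + s0\<close> with \<open>j < a\<close>, and with
  \<open>j = a\<close> if \<open>s0 < b\<close>. In a walk round a cycle of length \<open>r\<close>,
  this counts the passes over one edge.\<close>

lemma card_less_mod_eq:
  fixes a b r s0 :: nat
  assumes "s0 < r" and "b < r"
  shows "card {s. s < a * r + b \<and> s mod r = s0} = a + of_bool (s0 < b)"
proof -
  have *: "j * r + s0 < a * r + b \<longleftrightarrow> j < a + of_bool (s0 < b)" for j
  proof (cases j a rule: linorder_cases)
    case less
    then have "j * r + r \<le> a * r" by (metis Suc_leI mult_Suc mult_le_mono1 add.commute)
    then show ?thesis using less assms by simp
  next
    case greater
    then have "a * r + r \<le> j * r" by (metis Suc_leI mult_Suc mult_le_mono1 add.commute)
    then show ?thesis using greater assms by simp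
  qed simp
  have "{s. s < a * r + b \<and> s mod r = s0} = (\<lambda>j. j * r + s0) ` {..<a + of_bool (s0 < b)}"
  proof (intro equalityI subsetI)
    fix s assume "s \<in> {s. s < a * r + b \<and> s mod r = s0}"
    then have s: "s < a * r + b" "s mod r = s0" by simp_all
    then have eq: "s = s div r * r + s0" using div_mult_mod_eq[of s r] by simp
    have "s div r * r + s0 < a * r + b" using s(1) eq by linarith
    then have "s div r \<in> {..<a + of_bool (s0 < b)}" unfolding * lessThan_iff .
    with eq show "s \<in> (\<lambda>j. j * r + s0) ` {..<a + of_bool (s0 < b)}" by (rule image_eqI)
  next
    fix s assume "s \<in> (\<lambda>j. j * r + s0) ` {..<a + of_bool (s0 < b)}"
    then obtain j where "j < a + of_bool (s0 < b)" "s = j * r + s0" by blast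
    then show "s \<in> {s. s < a * r + b \<and> s mod r = s0}" using *[of j] assms(1) by simp
  qed
  moreover have "inj_on (\<lambda>j. j * r + s0) A" for A using assms by (auto intro!: inj_onI)
  ultimately show ?thesis by (simp add: card_image)
qed

section \<open>Label words along the orbits of a permutation\<close>

lemma funpow_funpow: "(f ^^ m) ((f ^^ n) x) = (f ^^ (m + n)) x"
  by (simp add: funpow_add)

lemma funpow_mult_fixpoint: "(f ^^ m) x = x \<Longrightarrow> (f ^^ (m * k)) x = x"
  by (induction k) (auto simp: funpow_add)

text \<open>
  For each label \<open>i\<close>, the restriction of \<open>\<pi>\<close> to the points labelled \<open>i\<close> is a partial automorphism.
\<close>

locale labelled_tournament =
  fixes L :: "nat set" and M :: "'a hypergraph" and \<pi> :: "'a \<Rightarrow> 'a"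
    and lab :: "'a \<Rightarrow> 'i" and I :: "'i set"
  assumes prime_L: "l \<in> L \<Longrightarrow> prime l"
    and tournament: "hypertournament L M"
    and permutes: "\<pi> permutes univ M"
    and lab_closed: "x \<in> univ M \<Longrightarrow> lab x \<in> I"
    and hom: "length xs \<in> L \<Longrightarrow> set xs \<subseteq> univ M \<Longrightarrow> (\<And>x. x \<in> set xs \<Longrightarrow> lab x = i) \<Longrightarrow>
      xs \<in> rel M (length xs) \<longleftrightarrow> map \<pi> xs \<in> rel M (length xs)"
begin

definition path_word :: "nat \<Rightarrow> 'a \<Rightarrow> 'i list" where
  "path_word t x = map (\<lambda>s. lab ((\<pi> ^^ s) x)) [0..<t]"

lemma funpow_closed: "x \<in> univ M \<Longrightarrow> (\<pi> ^^ t) x \<in> univ M"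
  using permutes_in_image[OF permutes_funpow[OF permutes]] by blast

lemma length_path_word [simp]: "length (path_word t x) = t"
  by (simp add: path_word_def)

lemma nth_path_word [simp]: "s < t \<Longrightarrow> path_word t x ! s = lab ((\<pi> ^^ s) x)"
  by (simp add: path_word_def)

lemma path_word_0 [simp]: "path_word 0 x = []"
  by (simp add: path_word_def)

lemma path_word_Suc: "path_word (Suc t) x = path_word t x @ [lab ((\<pi> ^^ t) x)]"
  by (simp add: path_word_def)

lemma take_path_word: "s \<le> t \<Longrightarrow> take s (path_word t x) = path_word s x"
  by (simp add: path_word_def take_map)

lemma set_path_word: "x \<in> univ M \<Longrightarrow> set (path_word t x) \<subseteq> I"
  by (auto simp: path_word_def intro!: lab_closed funpow_closed)

lemma path_word_add: "path_word (s + t) x = path_word s x @ path_word t ((\<pi> ^^ s) x)"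
  by (induction t) (auto simp: path_word_Suc funpow_funpow add.commute)

text \<open>Entries with a common label word pass through the same labels at the same times, so at
  each step \<open>hom\<close> applies to the whole tuple.\<close>

lemma rel_funpow:
  assumes "length xs \<in> L" and "set xs \<subseteq> univ M"
    and "\<And>x. x \<in> set xs \<Longrightarrow> path_word t x = w"
  shows "xs \<in> rel M (length xs) \<longleftrightarrow> map (\<pi> ^^ t) xs \<in> rel M (length xs)"
  using assms(3)
proof (induction t arbitrary: w)
  case (Suc t)
  have "path_word t x = butlast w" and lab: "lab ((\<pi> ^^ t) x) = last w" if "x \<in> set xs" for x
    using Suc.prems[OF that] by (auto simp: path_word_Suc)
  then have "xs \<in> rel M (length xs) \<longleftrightarrow> map (\<pi> ^^ t) xs \<in> rel M (length xs)"
    using Suc.IH by blast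
  also have "\<dots> \<longleftrightarrow> map \<pi> (map (\<pi> ^^ t) xs) \<in> rel M (length xs)"
    using hom[of "map (\<pi> ^^ t) xs" "last w"] assms lab funpow_closed by force
  finally show ?case by (simp add: comp_def)
qed simp

text \<open>
  Translating by \<open>s\<close> a point whose labels are invariant under the translation acts on the points
  it meets as a composition of partial automorphisms, so it cannot induce an \<open>l\<close>-cycle.
\<close>

lemma no_short_cycle:
  assumes x: "x \<in> univ M" and l: "l \<in> L" and labels: "\<And>i. lab ((\<pi> ^^ (i + s)) x) = lab ((\<pi> ^^ i) x)"
    and fix_l: "(\<pi> ^^ (s * l)) x = x"
  shows "(\<pi> ^^ s) x = x"
proof (rule ccontr)
  assume neq: "(\<pi> ^^ s) x \<noteq> x"
  have l1: "l > 1" using prime_L[OF l] prime_gt_1_nat by blast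
  define zs where "zs = map (\<lambda>j. (\<pi> ^^ (s * j)) x) [0..<l]"
  have len: "length zs = l" by (simp add: zs_def)
  have zs_M: "set zs \<subseteq> univ M" using x funpow_closed by (auto simp: zs_def)
  have lab_mult: "lab ((\<pi> ^^ (i + s * j)) x) = lab ((\<pi> ^^ i) x)" for i j
  proof (induction j)
    case (Suc j)
    then show ?case using labels[of "i + s * j"] by (simp add: algebra_simps)
  qed simp
  have word: "path_word t z = path_word t x" if "z \<in> set zs" for t z
    using that lab_mult by (auto simp: zs_def path_word_def funpow_funpow)
  have no_fix: False if d: "0 < d" "d < l" "(\<pi> ^^ (s * d)) x = x" for d
  proof -
    have "coprime d l"
      using prime_L[OF l] d by (metis coprime_commute nat_dvd_not_less prime_imp_coprime)
    \<comment> \<open>The shifts by \<open>s * d\<close> and by \<open>s * l\<close> both fix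
      \<open>x\<close>; since \<open>d\<close> and \<open>l\<close> are coprime, so does the shift
      by \<open>s\<close>.\<close>
    then obtain u v where uv: "d * u = l * v + 1"
      using bezout_nat[of d l] d by auto
    have "x = (\<pi> ^^ (s * d * u)) x" using funpow_mult_fixpoint[OF d(3)] by simp
    also have "s * d * u = s + s * l * v" using arg_cong[OF uv, of "\<lambda>n. s * n"] by (simp add: algebra_simps)
    also have "(\<pi> ^^ (s + s * l * v)) x = (\<pi> ^^ s) x"
      using funpow_mult_fixpoint[OF fix_l, of v] by (simp add: funpow_add)
    finally show False using neq by simp
  qed
  have ne: "(\<pi> ^^ (s * i)) x \<noteq> (\<pi> ^^ (s * j)) x" if ij: "i < j" "j < l" for i j
  proof
    assume "(\<pi> ^^ (s * i)) x = (\<pi> ^^ (s * j)) x"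
    then have "(\<pi> ^^ (s * j - s * i)) x = x"
      using funpow_diff[OF permutes_inj[OF permutes], of "s * i" "s * j" x] ij by simp
    then have "(\<pi> ^^ (s * (j - i))) x = x" by (simp only: diff_mult_distrib2)
    moreover have "0 < j - i" "j - i < l" using ij by linarith+
    ultimately show False using no_fix by blast
  qed
  have dist: "distinct zs"
    unfolding zs_def distinct_map by (auto intro!: inj_onI) (metis ne nat_neq_iff)
  have rot1: "rotate1 zs = map (\<pi> ^^ s) zs"
  proof (rule nth_equalityI)
    fix j assume j: "j < length (rotate1 zs)"
    show "rotate1 zs ! j = map (\<pi> ^^ s) zs ! j"
    proof (cases "Suc j = l")
      case True
      then have "(\<pi> ^^ s) ((\<pi> ^^ (s * j)) x) = x"
        using fix_l by (simp add: funpow_funpow flip: True)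
      then show ?thesis using True j l1 by (simp add: nth_rotate1 zs_def)
    next
      case False
      then show ?thesis using j len l1 by (simp add: nth_rotate1 zs_def funpow_add)
    qed
  qed simp
  have rot: "rotate i zs = map (\<pi> ^^ (s * i)) zs" for i
  proof (induction i)
    case (Suc i)
    then show ?case by (simp add: rotate1_map rot1 funpow_funpow add.commute)
  qed simp
  obtain \<sigma> where \<sigma>: "\<sigma> permutes {..<l}" "permute_list \<sigma> zs \<in> rel M l"
    using tournament l len dist zs_M unfolding hypertournament_def rel_perm_def by blast
  \<comment> \<open>The rotations of \<open>zs\<close> are its images under powers of
    \<open>\<pi> ^^ s\<close>, and all entries share their label words, so the same
    \<open>\<sigma>\<close> fits every rotation.\<close>
  have "permute_list \<sigma> (rotate i zs) \<in> rel M l" for i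
    using rel_funpow[of "permute_list \<sigma> zs" "s * i" "path_word (s * i) x"] \<sigma> len l zs_M word
    by (simp add: rot permute_list_map)
  then show False
    using hypertournament_no_rotation[OF tournament l \<sigma>(1) len zs_M dist] by blast
qed

text \<open>The primes of \<open>k\<close> are removed one at a time: for \<open>k = m * l\<close>,
  applying \<open>no_short_cycle\<close> to the shift \<open>s * m\<close> leaves the smaller factor
  \<open>m\<close>.\<close>

lemma no_cycle:
  assumes x: "x \<in> univ M" and labels: "\<And>i. lab ((\<pi> ^^ (i + s)) x) = lab ((\<pi> ^^ i) x)"
    and "k > 0" and "\<And>r. prime r \<Longrightarrow> r dvd k \<Longrightarrow> r \<in> L" and "(\<pi> ^^ (s * k)) x = x"
  shows "(\<pi> ^^ s) x = x"
  using assms(3-)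
proof (induction k rule: less_induct)
  case (less k)
  show ?case
  proof (cases "k = 1")
    case True
    then show ?thesis using less.prems by simp
  next
    case False
    then obtain l where l: "prime l" "l dvd k" by (metis prime_factor_nat)
    then obtain m where m: "k = m * l" by (metis dvd_div_mult_self)
    have labels_m: "lab ((\<pi> ^^ (i + s * j)) x) = lab ((\<pi> ^^ i) x)" for i j
    proof (induction j)
      case (Suc j)
      then show ?case using labels[of "i + s * j"] by (simp add: algebra_simps)
    qed simp
    have "l \<in> L" using less.prems(2) l by blast
    moreover have "(\<pi> ^^ (s * m * l)) x = x" using less.prems(3) by (simp only: m mult.assoc)
    ultimately have "(\<pi> ^^ (s * m)) x = x" by (rule no_short_cycle[OF x _ labels_m])
    moreover have "m < k" "m > 0" using m l less.prems(1) prime_gt_1_nat[OF l(1)] by auto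
    ultimately show ?thesis using less.IH[of m] less.prems(2) m by (metis dvd_mult2)
  qed
qed

end

text \<open>As \<open>q\<close> must avoid the primes in \<open>L\<close>, it cannot always be a
  multiple of the period \<open>K\<close>. The factor \<open>k\<close> makes up for this; its primes
  are in \<open>L\<close>, so \<open>no_cycle\<close> can remove it. The bound
  \<open>K \<le> q\<close> allows words of length \<open>K\<close> to be recovered from their
  products.\<close>

locale labelled_tournament_period = labelled_tournament L M \<pi> lab I
    for L and M :: "'a hypergraph" and \<pi> and lab :: "'a \<Rightarrow> 'i" and I +
  fixes q K k :: nat
  assumes finite_I: "finite I"
    and period: "x \<in> univ M \<Longrightarrow> (\<pi> ^^ K) x = x"
    and K: "0 < K" "K \<le> q" and q: "1 < q"
    and coprime_q: "l \<in> L \<Longrightarrow> \<not> l dvd q"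
    and k: "0 < k" "K dvd q * k" and prime_k: "prime r \<Longrightarrow> r dvd k \<Longrightarrow> r \<in> L"
begin

text \<open>
  The group \<open>base_grp\<close> is \<open>H\<close> and \<open>top_grp\<close> is \<open>G\<close>; accordingly, \<open>pos\<close> and \<open>top_pos\<close> below are the
  values of \<open>w(t, x)\<close> in \<open>H\<close> and \<open>G\<close>.
\<close>

abbreviation "base_grp \<equiv> wreath (integer_mod_group q) I q"

abbreviation "base_gen \<equiv> wreath_gen (integer_mod_group q) I (\<lambda>_. 1)"

abbreviation "top_grp \<equiv> wreath base_grp I q"

abbreviation "top_gen \<equiv> wreath_gen base_grp I base_gen"

lemma group_base: "group base_grp"
  by (rule group_wreath) (use q in simp_all)

lemma group_top: "group top_grp"
  by (rule group_wreath[OF group_base]) (use q in simp)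

lemma base_gen: "base_gen ` I \<subseteq> carrier base_grp"
  by (rule image_subsetI, rule wreath_gen_closed[OF _ q]) (use q in \<open>simp add: carrier_integer_mod_group\<close>)

lemma top_gen: "top_gen ` I \<subseteq> carrier top_grp"
  by (rule image_subsetI, rule wreath_gen_closed[OF _ q]) (use base_gen in blast)

lemma base_exponent: "g \<in> carrier base_grp \<Longrightarrow> g [^]\<^bsub>base_grp\<^esub> (q * q) = \<one>\<^bsub>base_grp\<^esub>"
  by (rule wreath_exponent) (use q in simp_all)

lemma top_exponent: "g \<in> carrier top_grp \<Longrightarrow> g [^]\<^bsub>top_grp\<^esub> (q * q * q) = \<one>\<^bsub>top_grp\<^esub>"
  by (rule wreath_exponent[OF group_base _ base_exponent]) (use q in simp_all)

lemma finite_top: "finite (carrier top_grp)"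
  using q finite_I by (intro finite_wreath) (auto simp: carrier_integer_mod_group)

definition pos :: "nat \<Rightarrow> 'a \<Rightarrow> int \<times> (int \<times> 'i \<Rightarrow> int)" where
  "pos t x = word_prod base_grp base_gen (path_word t x)"

definition top_pos :: "nat \<Rightarrow> 'a \<Rightarrow> (int \<times> (int \<times> 'i \<Rightarrow> int)) \<times> ((int \<times> (int \<times> 'i \<Rightarrow> int)) \<times> 'i \<Rightarrow> int)" where
  "top_pos t x = word_prod top_grp top_gen (path_word t x)"

lemma pos_closed: "x \<in> univ M \<Longrightarrow> pos t x \<in> carrier base_grp"
  unfolding pos_def by (rule monoid.word_prod_closed[OF group.is_monoid[OF group_base] base_gen set_path_word])

lemma top_pos_closed: "x \<in> univ M \<Longrightarrow> top_pos t x \<in> carrier top_grp"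
  unfolding top_pos_def by (rule monoid.word_prod_closed[OF group.is_monoid[OF group_top] top_gen set_path_word])

lemma pos_0 [simp]: "pos 0 x = \<one>\<^bsub>base_grp\<^esub>"
  by (simp add: pos_def)

lemma pos_add: "x \<in> univ M \<Longrightarrow> pos (s + t) x = pos s x \<otimes>\<^bsub>base_grp\<^esub> pos t ((\<pi> ^^ s) x)"
  unfolding pos_def path_word_add
  by (rule monoid.word_prod_append[OF group.is_monoid[OF group_base] base_gen set_path_word set_path_word[OF funpow_closed]])

lemma top_pos_add: "x \<in> univ M \<Longrightarrow> top_pos (s + t) x = top_pos s x \<otimes>\<^bsub>top_grp\<^esub> top_pos t ((\<pi> ^^ s) x)"
  unfolding top_pos_def path_word_add
  by (rule monoid.word_prod_append[OF group.is_monoid[OF group_top] top_gen set_path_word set_path_word[OF funpow_closed]])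

lemma top_pos_eq:
  assumes "x \<in> univ M"
  shows "top_pos t x = (pos t x, \<lambda>z\<in>carrier base_grp \<times> I.
    int (card {s. s < t \<and> pos s x = fst z \<and> lab ((\<pi> ^^ s) x) = snd z}) mod int q)"
proof -
  have "{s. s < length (path_word t x) \<and> word_prod base_grp base_gen (take s (path_word t x)) = fst z \<and>
      path_word t x ! s = snd z} = {s. s < t \<and> pos s x = fst z \<and> lab ((\<pi> ^^ s) x) = snd z}" for z
    by (auto simp: pos_def take_path_word)
  then show ?thesis
    unfolding top_pos_def by (simp only: word_prod_wreath[OF group_base q base_gen set_path_word[OF assms]] pos_def)
qed

text \<open>
  A closed walk commutes with every other one, in particular with the walk of length \<open>K\<close>; short
  words being determined by their value, the labels of \<open>x\<close> are then invariant under translation.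
\<close>

lemma closed_walk:
  assumes x: "x \<in> univ M" and t: "pos t x = \<one>\<^bsub>base_grp\<^esub>"
  shows "(\<pi> ^^ t) x = x"
proof -
  interpret base: group base_grp by (rule group_base)
  let ?y = "(\<pi> ^^ t) x"
  have y: "?y \<in> univ M" using x by (rule funpow_closed)
  have "pos K x = pos (K + t) x"
    by (simp only: pos_add[OF x] period[OF x] t base.r_one[OF pos_closed[OF x]])
  also have "\<dots> = pos (t + K) x"
    by (simp only: add.commute)
  also have "\<dots> = pos K ?y"
    by (simp only: pos_add[OF x] t base.l_one[OF pos_closed[OF y]])
  finally have "path_word K x = path_word K ?y"
    unfolding pos_def
    by (rule word_prod_wreath_inject[OF q set_path_word[OF x] set_path_word[OF y], rotated 2]) (use K in simp_all)
  then have "lab ((\<pi> ^^ i) x) = lab ((\<pi> ^^ i) ?y)" if "i < K" for i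
    using that by (metis nth_path_word)
  then have "lab ((\<pi> ^^ (i mod K)) x) = lab ((\<pi> ^^ (i mod K)) ?y)" for i
    using K by simp
  then have "lab ((\<pi> ^^ i) x) = lab ((\<pi> ^^ i) ?y)" for i
    using period[OF x] period[OF y] by (simp add: funpow_mod_eq)
  then have labels: "lab ((\<pi> ^^ (i + t)) x) = lab ((\<pi> ^^ i) x)" for i
    by (simp add: funpow_funpow)
  have "(\<lambda>_. 1) ` I \<subseteq> carrier (integer_mod_group q)"
    using q by (auto simp: carrier_integer_mod_group)
  \<comment> \<open>The cursor in the cyclic group counts steps, so \<open>q\<close> divides the
    length of a closed walk.\<close>
  then have "fst (pos t x) = int t mod int q"
    unfolding pos_def using word_prod_wreath[OF group_integer_mod_group q _ set_path_word[OF x]]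
    by (simp add: word_prod_integer_mod_group[OF q])
  then have "int t mod int q = 0" using t by (simp add: one_wreath)
  then have "q dvd t" by presburger
  \<comment> \<open>The period \<open>K\<close> may fail to divide \<open>t\<close>, but it divides
    \<open>t * k\<close>; \<open>no_cycle\<close> then discards \<open>k\<close>.\<close>
  then have "K dvd t * k" using k by (metis dvd_trans dvd_refl mult_dvd_mono)
  then obtain j where "t * k = K * j" by (rule dvdE)
  then have fixpoint: "(\<pi> ^^ (t * k)) x = x" using funpow_mult_fixpoint[OF period[OF x], of j] by simp
  show ?thesis by (rule no_cycle[OF x labels k(1) prime_k fixpoint])
qed

section \<open>Return times and edge counts of walks\<close>

lemma pos_eq:
  assumes x: "x \<in> univ M" and "s \<le> t" and "pos s x = pos t x"
  shows "(\<pi> ^^ t) x = (\<pi> ^^ s) x"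
proof -
  have "pos s x \<otimes>\<^bsub>base_grp\<^esub> pos (t - s) ((\<pi> ^^ s) x) = pos (s + (t - s)) x"
    by (rule pos_add[OF x, symmetric])
  also have "\<dots> = pos t x" using assms(2) by simp
  also note assms(3)[symmetric]
  finally have "pos s x \<otimes>\<^bsub>base_grp\<^esub> pos (t - s) ((\<pi> ^^ s) x) = pos s x" .
  then have "pos (t - s) ((\<pi> ^^ s) x) = \<one>\<^bsub>base_grp\<^esub>"
    by (rule iffD1[OF group.l_cancel_one[OF group_base pos_closed[OF x] pos_closed[OF funpow_closed[OF x]]]])
  then have "(\<pi> ^^ (t - s)) ((\<pi> ^^ s) x) = (\<pi> ^^ s) x"
    by (rule closed_walk[OF funpow_closed[OF x]])
  then show ?thesis using \<open>s \<le> t\<close> by (simp add: funpow_funpow)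
qed

text \<open>It is a multiple of the period of \<open>x\<close> under \<open>\<pi>\<close> and in
  general larger, since the product of the labels must be trivial as well.\<close>

definition return_time :: "'a \<Rightarrow> nat" where
  "return_time x = (LEAST r. 0 < r \<and> pos r x = \<one>\<^bsub>base_grp\<^esub>)"

lemma pos_mult_period:
  assumes x: "x \<in> univ M" and "(\<pi> ^^ r) x = x"
  shows "pos (r * j) x = pos r x [^]\<^bsub>base_grp\<^esub> j"
proof (induction j)
  case (Suc j)
  have "pos (r * j + r) x = pos (r * j) x \<otimes>\<^bsub>base_grp\<^esub> pos r x"
    using pos_add[OF x] funpow_mult_fixpoint[OF assms(2)] by simp
  then show ?case unfolding Suc mult_Suc_right add.commute[of r] by simp
qed simp

text \<open>After \<open>K\<close> steps the walk is back over \<open>x\<close>, so its value after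
  \<open>K * (q * q)\<close> steps is a power with exponent \<open>q * q\<close>, which is
  trivial.\<close>

lemma return_time:
  assumes x: "x \<in> univ M"
  shows "0 < return_time x" and "pos (return_time x) x = \<one>\<^bsub>base_grp\<^esub>"
proof -
  have "pos (K * (q * q)) x = \<one>\<^bsub>base_grp\<^esub>"
    using pos_mult_period[OF x period[OF x]] base_exponent[OF pos_closed[OF x]] by metis
  then have "0 < K * (q * q) \<and> pos (K * (q * q)) x = \<one>\<^bsub>base_grp\<^esub>" using K q by simp
  then have *: "0 < return_time x \<and> pos (return_time x) x = \<one>\<^bsub>base_grp\<^esub>"
    unfolding return_time_def by (rule LeastI)
  show "0 < return_time x" using * ..
  show "pos (return_time x) x = \<one>\<^bsub>base_grp\<^esub>" using * ..
qed

lemma pos_neq_one: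
  assumes "x \<in> univ M" and "0 < s" and "s < return_time x"
  shows "pos s x \<noteq> \<one>\<^bsub>base_grp\<^esub>"
proof
  assume "pos s x = \<one>\<^bsub>base_grp\<^esub>"
  then have "return_time x \<le> s"
    unfolding return_time_def using assms(2) by (intro Least_le conjI)
  then show False using assms(3) by simp
qed

lemma funpow_return_time: "x \<in> univ M \<Longrightarrow> (\<pi> ^^ return_time x) x = x"
  by (intro closed_walk return_time(2))

lemma pos_return_time:
  assumes x: "x \<in> univ M"
  shows "pos (a * return_time x + b) x = pos b x"
proof -
  interpret base: group base_grp by (rule group_base)
  have "pos (return_time x * a) x = \<one>\<^bsub>base_grp\<^esub>"
    using pos_mult_period[OF x funpow_return_time[OF x]] return_time(2)[OF x] by simp
  moreover have "(\<pi> ^^ (return_time x * a)) x = x"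
    using funpow_mult_fixpoint[OF funpow_return_time[OF x]] .
  ultimately have "pos (return_time x * a + b) x = pos b x"
    using pos_add[OF x, of "return_time x * a" b] pos_closed[OF x] by simp
  then show ?thesis by (simp only: mult.commute[of a])
qed

lemma pos_mod: "x \<in> univ M \<Longrightarrow> pos (t mod return_time x) x = pos t x"
  by (rule sym) (rule pos_return_time[of x "t div return_time x" "t mod return_time x", unfolded div_mult_mod_eq])

lemma funpow_mod: "x \<in> univ M \<Longrightarrow> (\<pi> ^^ (t mod return_time x)) x = (\<pi> ^^ t) x"
  by (metis funpow_mod_eq funpow_return_time)

text \<open>A walk that met itself would be over the same point of \<open>M\<close> both times, by
  \<open>pos_eq\<close>. The steps remaining after the later time, taken from the earlier one, would
  then close it too soon.\<close>

lemma pos_inj: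
  assumes x: "x \<in> univ M" and "s < t" and t: "t < return_time x"
  shows "pos s x \<noteq> pos t x"
proof (rule notI)
  assume eq: "pos s x = pos t x"
  have fixpoint: "(\<pi> ^^ t) x = (\<pi> ^^ s) x"
    by (rule pos_eq[OF x less_imp_le[OF assms(2)] eq])
  have "pos (s + (return_time x - t)) x = pos (t + (return_time x - t)) x"
    unfolding pos_add[OF x] fixpoint eq ..
  also have "\<dots> = pos (return_time x) x" using t by simp
  also note return_time(2)[OF x]
  finally have "pos (s + (return_time x - t)) x = \<one>\<^bsub>base_grp\<^esub>" .
  moreover have "0 < s + (return_time x - t)" and "s + (return_time x - t) < return_time x"
    using assms by linarith+
  then have "pos (s + (return_time x - t)) x \<noteq> \<one>\<^bsub>base_grp\<^esub>"
    by (rule pos_neq_one[OF x])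
  ultimately show False by contradiction
qed

lemma pos_eq_iff:
  assumes x: "x \<in> univ M" and s0: "s0 < return_time x"
  shows "pos s x = pos s0 x \<longleftrightarrow> s mod return_time x = s0"
proof -
  have "pos s x = pos s0 x \<longleftrightarrow> pos (s mod return_time x) x = pos s0 x"
    by (simp only: pos_mod[OF x])
  also have "\<dots> \<longleftrightarrow> s mod return_time x = s0"
  proof (cases "s mod return_time x" s0 rule: linorder_cases)
    case less
    then show ?thesis using pos_inj[OF x less s0] by simp
  next
    case greater
    have "s mod return_time x < return_time x" using return_time(1)[OF x] by simp
    then show ?thesis using pos_inj[OF x greater] greater by fastforce
  qed simp
  finally show ?thesis .
qed

text \<open>The walk runs \<open>t div return_time x\<close> times round a simple cycle and then
  over its first \<open>t mod return_time x\<close> edges; both parts contribute to the count at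
  edge number \<open>s0\<close>.\<close>

lemma flow_nonzero:
  assumes x: "x \<in> univ M" and s0: "s0 < return_time x" and i: "i \<in> I"
  shows "snd (top_pos t x) (pos s0 x, i) \<noteq> 0 \<longleftrightarrow>
    lab ((\<pi> ^^ s0) x) = i \<and> \<not> q dvd t div return_time x + of_bool (s0 < t mod return_time x)"
proof -
  let ?r = "return_time x"
  let ?A = "{s. s < t \<and> pos s x = pos s0 x \<and> lab ((\<pi> ^^ s) x) = i}"
  have "?A = (if lab ((\<pi> ^^ s0) x) = i then {s. s < t div ?r * ?r + t mod ?r \<and> s mod ?r = s0} else {})"
    unfolding pos_eq_iff[OF x s0] using funpow_mod[OF x] by auto
  moreover have "card {s. s < t div ?r * ?r + t mod ?r \<and> s mod ?r = s0} = t div ?r + of_bool (s0 < t mod ?r)"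
    using s0 by (intro card_less_mod_eq) auto
  ultimately have card: "card ?A = (if lab ((\<pi> ^^ s0) x) = i then t div ?r + of_bool (s0 < t mod ?r) else 0)"
    by simp
  have "(pos s0 x, i) \<in> carrier base_grp \<times> I"
    using pos_closed[OF x] i by (rule SigmaI)
  then have "snd (top_pos t x) (pos s0 x, i) = int (card ?A) mod int q"
    unfolding top_pos_eq[OF x] snd_conv by (simp only: restrict_apply' fst_conv snd_conv)
  then have "snd (top_pos t x) (pos s0 x, i) \<noteq> 0 \<longleftrightarrow> \<not> q dvd card ?A"
    by (simp only: of_nat_dvd_iff flip: dvd_eq_mod_eq_0)
  then show ?thesis unfolding card by (simp split: if_splits)
qed

text \<open>At each vertex of either walk the nonzero values of \<open>F\<close> single out one
  label, so the walks read the same letters and stay together as long as both last.\<close>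

lemma walks_agree_aux:
  fixes F :: "(int \<times> (int \<times> 'i \<Rightarrow> int)) \<times> 'i \<Rightarrow> int"
  assumes z: "z \<in> univ M"
    and F: "\<And>s i. s < c \<Longrightarrow> i \<in> I \<Longrightarrow> F (g \<otimes>\<^bsub>base_grp\<^esub> pos s z, i) \<noteq> 0 \<longleftrightarrow> lab ((\<pi> ^^ s) z) = i"
    and F': "\<And>s i. s < c' \<Longrightarrow> i \<in> I \<Longrightarrow> F (g \<otimes>\<^bsub>base_grp\<^esub> pos s z', i) \<noteq> 0 \<longleftrightarrow> lab ((\<pi> ^^ s) z') = i"
  shows "s \<le> c \<Longrightarrow> s \<le> c' \<Longrightarrow> path_word s z = path_word s z'"
proof (induction s)
  case (Suc s)
  then have word: "path_word s z = path_word s z'" by simp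
  then have eq: "pos s z = pos s z'" by (simp only: pos_def)
  have i: "lab ((\<pi> ^^ s) z) \<in> I" using z by (intro lab_closed funpow_closed)
  have "F (g \<otimes>\<^bsub>base_grp\<^esub> pos s z, lab ((\<pi> ^^ s) z)) \<noteq> 0"
    using F[OF _ i, of s] Suc.prems by simp
  then have "lab ((\<pi> ^^ s) z') = lab ((\<pi> ^^ s) z)"
    unfolding eq using F'[OF _ i, of s] Suc.prems by simp
  then show ?case by (simp add: path_word_Suc word)
qed simp

text \<open>
  A nowhere returning walk from \<open>g\<close> to \<open>e\<close> is determined by its set of traversed edges.
\<close>

lemma walks_agree:
  fixes F :: "(int \<times> (int \<times> 'i \<Rightarrow> int)) \<times> 'i \<Rightarrow> int"
  assumes z: "z \<in> univ M" and z': "z' \<in> univ M"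
    and F: "\<And>s i. s < c \<Longrightarrow> i \<in> I \<Longrightarrow> F (g \<otimes>\<^bsub>base_grp\<^esub> pos s z, i) \<noteq> 0 \<longleftrightarrow> lab ((\<pi> ^^ s) z) = i"
    and F': "\<And>s i. s < c' \<Longrightarrow> i \<in> I \<Longrightarrow> F (g \<otimes>\<^bsub>base_grp\<^esub> pos s z', i) \<noteq> 0 \<longleftrightarrow> lab ((\<pi> ^^ s) z') = i"
    and e: "g \<otimes>\<^bsub>base_grp\<^esub> pos c z = e" and e': "g \<otimes>\<^bsub>base_grp\<^esub> pos c' z' = e"
    and ne: "\<And>s. s < c \<Longrightarrow> g \<otimes>\<^bsub>base_grp\<^esub> pos s z \<noteq> e"
    and ne': "\<And>s. s < c' \<Longrightarrow> g \<otimes>\<^bsub>base_grp\<^esub> pos s z' \<noteq> e"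
  shows "c = c' \<and> path_word c z = path_word c' z'"
proof -
  have word: "path_word s z = path_word s z'" if "s \<le> c" "s \<le> c'" for s
    by (rule walks_agree_aux[OF z F F' that])
  have "\<not> c < c'"
  proof
    assume "c < c'"
    then have "pos c z = pos c z'" unfolding pos_def by (simp only: word less_imp_le)
    then show False using ne'[OF \<open>c < c'\<close>] e by simp
  qed
  moreover have "\<not> c' < c"
  proof
    assume "c' < c"
    then have "pos c' z = pos c' z'" unfolding pos_def by (simp only: word less_imp_le)
    then show False using ne[OF \<open>c' < c\<close>] e' by simp
  qed
  ultimately have "c = c'" by simp
  then show ?thesis using word by simp
qed

text \<open>
  The common value \<open>\<gamma>\<close> of the walks records, for each \<open>x\<close>, a multiple of the simple closed walk of
  \<open>x\<close> plus the simple walk to its end. If \<open>\<gamma>\<close> uses an edge at the origin, the walks to the ends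
  all coincide; otherwise the complementary walks, from the ends back to the origin, do.
\<close>

lemma rel_walks:
  assumes len: "length xs \<in> L" and xs: "set xs \<subseteq> univ M"
    and \<gamma>: "\<And>x. x \<in> set xs \<Longrightarrow> top_pos (t x) x = \<gamma>"
  shows "xs \<in> rel M (length xs) \<longleftrightarrow> map (\<lambda>x. (\<pi> ^^ t x) x) xs \<in> rel M (length xs)"
proof -
  interpret base: group base_grp by (rule group_base)
  obtain h f where hf: "\<gamma> = (h, f)" by fastforce
  define b where "b x = t x mod return_time x" for x
  have xM: "x \<in> univ M" if "x \<in> set xs" for x
    using xs that by (rule subsetD)
  have pos_t: "pos (t x) x = h" if "x \<in> set xs" for x
    using \<gamma>[OF that] unfolding hf top_pos_eq[OF xM[OF that]] by simp
  have pos_b: "pos (b x) x = h" if "x \<in> set xs" for x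
    unfolding b_def pos_mod[OF xM[OF that]] by (rule pos_t[OF that])
  have b_less: "b x < return_time x" if "x \<in> set xs" for x
    unfolding b_def by (rule mod_less_divisor[OF return_time(1)[OF xM[OF that]]])
  have funpow_b: "(\<pi> ^^ b x) x = (\<pi> ^^ t x) x" if "x \<in> set xs" for x
    unfolding b_def by (rule funpow_mod[OF xM[OF that]])
  have f: "f (pos s x, i) \<noteq> 0 \<longleftrightarrow> lab ((\<pi> ^^ s) x) = i \<and> \<not> q dvd t x div return_time x + of_bool (s < b x)"
    if x: "x \<in> set xs" and "s < return_time x" "i \<in> I" for x s i
    using flow_nonzero[OF xM[OF x] that(2,3), of "t x"] unfolding \<gamma>[OF x] hf b_def snd_conv .
  have "xs \<noteq> []" using prime_L[OF len] by auto
  then obtain x0 where x0: "x0 \<in> set xs" by (metis list.set_intros(1) neq_Nil_conv)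
  show ?thesis
  proof (cases "h = \<one>\<^bsub>base_grp\<^esub>")
    case True
    have "(\<pi> ^^ t x) x = x" if "x \<in> set xs" for x
      by (rule closed_walk[OF xM[OF that]]) (simp only: pos_t[OF that] True)
    then have "map (\<lambda>x. (\<pi> ^^ t x) x) xs = xs" by (simp add: map_idI)
    then show ?thesis by simp
  next
    case False
    have b_pos: "0 < b x" if "x \<in> set xs" for x
      using pos_b[OF that] False by (metis pos_0 gr0I)
    have f0: "f (\<one>\<^bsub>base_grp\<^esub>, i) \<noteq> 0 \<longleftrightarrow> lab x = i \<and> \<not> q dvd t x div return_time x + 1"
      if "x \<in> set xs" "i \<in> I" for x i
      using f[of x 0 i] b_pos[OF that(1)] b_less[OF that(1)] that by simp
    show ?thesis
    proof (cases "\<exists>i\<in>I. f (\<one>\<^bsub>base_grp\<^esub>, i) \<noteq> 0")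
      case True
      have one: "\<one>\<^bsub>base_grp\<^esub> \<otimes>\<^bsub>base_grp\<^esub> pos s y = pos s y" if "y \<in> set xs" for s y
        by (rule base.l_one[OF pos_closed[OF xM[OF that]]])
      have end_b: "\<one>\<^bsub>base_grp\<^esub> \<otimes>\<^bsub>base_grp\<^esub> pos (b y) y = h" if "y \<in> set xs" for y
        unfolding one[OF that] by (rule pos_b[OF that])
      have simple_b: "\<one>\<^bsub>base_grp\<^esub> \<otimes>\<^bsub>base_grp\<^esub> pos s y \<noteq> h" if y: "y \<in> set xs" and s: "s < b y" for s y
        using pos_inj[OF xM[OF y] s b_less[OF y]] pos_b[OF y] one[OF y] by simp
      have edges_b: "f (\<one>\<^bsub>base_grp\<^esub> \<otimes>\<^bsub>base_grp\<^esub> pos s y, i) \<noteq> 0 \<longleftrightarrow> lab ((\<pi> ^^ s) y) = i"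
        if y: "y \<in> set xs" and s: "s < b y" and i: "i \<in> I" for s y i
      proof -
        \<comment> \<open>Since some edge at the origin has a nonzero value, the multiplicity of the
          first \<open>b y\<close> edges is nonzero modulo \<open>q\<close>, for every entry
          \<open>y\<close>.\<close>
        have "\<not> q dvd t y div return_time y + 1" using True f0[OF y] by blast
        then show ?thesis
          unfolding one[OF y] using f[OF y less_trans[OF s b_less[OF y]] i] s by simp
      qed
      have agree: "b x = b x0 \<and> path_word (b x) x = path_word (b x0) x0" if x: "x \<in> set xs" for x
        by (rule walks_agree[OF xM[OF x] xM[OF x0] edges_b[OF x] edges_b[OF x0]
          end_b[OF x] end_b[OF x0] simple_b[OF x] simple_b[OF x0]])
      have "(\<pi> ^^ t x) x = (\<pi> ^^ b x0) x" if "x \<in> set xs" for x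
        using funpow_b[OF that] agree[OF that] by simp
      then have "map (\<lambda>x. (\<pi> ^^ t x) x) xs = map (\<pi> ^^ b x0) xs"
        by (rule map_cong[OF refl])
      moreover have "xs \<in> rel M (length xs) \<longleftrightarrow> map (\<pi> ^^ b x0) xs \<in> rel M (length xs)"
      proof (rule rel_funpow[OF len xs])
        fix x assume "x \<in> set xs"
        then show "path_word (b x0) x = path_word (b x0) x0" using agree by fastforce
      qed
      ultimately show ?thesis by (simp only:)
    next
      case zero: False
      define c where "c x = return_time x - b x" for x
      define y where "y x = (\<pi> ^^ b x) x" for x
      have yM: "y x \<in> univ M" if "x \<in> set xs" for x
        unfolding y_def by (rule funpow_closed[OF xM[OF that]])
      have h_pos: "h \<otimes>\<^bsub>base_grp\<^esub> pos s (y x) = pos (b x + s) x" if "x \<in> set xs" for x s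
        unfolding y_def by (simp only: pos_add[OF xM[OF that]] pos_b[OF that])
      have c: "b x + c x = return_time x" if "x \<in> set xs" for x
        using b_less[OF that] by (simp add: c_def)
      have end_c: "h \<otimes>\<^bsub>base_grp\<^esub> pos (c w) (y w) = \<one>\<^bsub>base_grp\<^esub>" if w: "w \<in> set xs" for w
        unfolding h_pos[OF w] c[OF w] by (rule return_time(2)[OF xM[OF w]])
      have simple_c: "h \<otimes>\<^bsub>base_grp\<^esub> pos s (y w) \<noteq> \<one>\<^bsub>base_grp\<^esub>" if w: "w \<in> set xs" and s: "s < c w" for s w
        unfolding h_pos[OF w] using b_pos[OF w] c[OF w] s by (intro pos_neq_one[OF xM[OF w]]) linarith+
      have edges_c: "f (h \<otimes>\<^bsub>base_grp\<^esub> pos s (y w), i) \<noteq> 0 \<longleftrightarrow> lab ((\<pi> ^^ s) (y w)) = i"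
        if w: "w \<in> set xs" and s: "s < c w" and i: "i \<in> I" for s w i
      proof -
        have s': "b w + s < return_time w" using c[OF w] s by linarith
        have "lab w \<in> I" by (rule lab_closed[OF xM[OF w]])
        \<comment> \<open>The edge by which the walk of \<open>w\<close> leaves the origin has count
          \<open>0\<close> modulo \<open>q\<close>. The edges after the first \<open>b w\<close>
          ones are traversed once less, so their counts are nonzero.\<close>
        then have "q dvd t w div return_time w + 1" using zero f0[OF w, of "lab w"] by blast
        then have "\<not> q dvd t w div return_time w"
          using q by (metis dvd_add_right_iff nat_dvd_1_iff_1 less_irrefl)
        then show ?thesis
          unfolding h_pos[OF w] using f[OF w s' i] by (simp add: y_def funpow_funpow add.commute)
      qed
      have agree: "c x = c x0 \<and> path_word (c x) (y x) = path_word (c x0) (y x0)" if x: "x \<in> set xs" for x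
        by (rule walks_agree[OF yM[OF x] yM[OF x0] edges_c[OF x] edges_c[OF x0]
          end_c[OF x] end_c[OF x0] simple_c[OF x] simple_c[OF x0]])
      have "(\<pi> ^^ c x0) (y x) = x" if x: "x \<in> set xs" for x
      proof -
        have "(\<pi> ^^ c x) (y x) = (\<pi> ^^ return_time x) x"
          by (simp only: y_def funpow_funpow add.commute[of "c x"] c[OF x])
        then show ?thesis using agree[OF x] funpow_return_time[OF xM[OF x]] by simp
      qed
      then have return: "map (\<pi> ^^ c x0) (map y xs) = xs" by (simp add: map_idI)
      \<comment> \<open>The common composition now leads from the end points back to
        \<open>xs\<close>, so the equivalence is read from right to left.\<close>
      have "map y xs \<in> rel M (length (map y xs)) \<longleftrightarrow>
          map (\<pi> ^^ c x0) (map y xs) \<in> rel M (length (map y xs))"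
      proof (rule rel_funpow)
        fix z assume "z \<in> set (map y xs)"
        then obtain x where "x \<in> set xs" "z = y x" by auto
        then show "path_word (c x0) z = path_word (c x0) (y x0)" using agree by fastforce
      qed (use len yM in auto)
      moreover have "map (\<lambda>x. (\<pi> ^^ t x) x) xs = map y xs"
        using funpow_b by (simp add: y_def)
      ultimately show ?thesis unfolding return length_map by (simp only:)
    qed
  qed
qed

section \<open>The extension\<close>

text \<open>Forward steps suffice to form the whole class, because walks are periodic both in
  \<open>M\<close> and in the group.\<close>

definition cls :: "(int \<times> (int \<times> 'i \<Rightarrow> int)) \<times> ((int \<times> (int \<times> 'i \<Rightarrow> int)) \<times> 'i \<Rightarrow> int) \<Rightarrow> 'a \<Rightarrow>
    (((int \<times> (int \<times> 'i \<Rightarrow> int)) \<times> ((int \<times> (int \<times> 'i \<Rightarrow> int)) \<times> 'i \<Rightarrow> int)) \<times> 'a) set" where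
  "cls g x = range (\<lambda>t. (g \<otimes>\<^bsub>top_grp\<^esub> top_pos t x, (\<pi> ^^ t) x))"

lemma top_pos_0: "top_pos 0 x = \<one>\<^bsub>top_grp\<^esub>"
  by (simp only: top_pos_def path_word_0 word_prod_Nil)

lemma cls_refl:
  assumes "g \<in> carrier top_grp"
  shows "(g, x) \<in> cls g x"
  unfolding cls_def
proof (rule range_eqI)
  show "(g, x) = (g \<otimes>\<^bsub>top_grp\<^esub> top_pos 0 x, (\<pi> ^^ 0) x)"
    by (simp only: top_pos_0 monoid.r_one[OF group.is_monoid[OF group_top] assms] funpow_0)
qed

lemma cls_subset:
  assumes g: "g \<in> carrier top_grp" and x: "x \<in> univ M"
  shows "cls (g \<otimes>\<^bsub>top_grp\<^esub> top_pos s x) ((\<pi> ^^ s) x) \<subseteq> cls g x"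
proof -
  have "(g \<otimes>\<^bsub>top_grp\<^esub> top_pos s x) \<otimes>\<^bsub>top_grp\<^esub> top_pos t ((\<pi> ^^ s) x) = g \<otimes>\<^bsub>top_grp\<^esub> top_pos (s + t) x" for t
    unfolding top_pos_add[OF x]
    by (rule monoid.m_assoc[OF group.is_monoid[OF group_top] g top_pos_closed[OF x] top_pos_closed[OF funpow_closed[OF x]]])
  moreover have "(\<pi> ^^ t) ((\<pi> ^^ s) x) = (\<pi> ^^ (s + t)) x" for t
    by (simp only: funpow_funpow add.commute)
  ultimately show ?thesis
    unfolding cls_def by (simp only:) blast
qed

lemma top_pos_mult:
  assumes x: "x \<in> univ M" and r: "(\<pi> ^^ r) x = x"
  shows "top_pos (r * j) x = top_pos r x [^]\<^bsub>top_grp\<^esub> j"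
proof (induction j)
  case 0
  show ?case by (simp only: mult_0_right top_pos_0 group.is_monoid[OF group_top, THEN monoid.nat_pow_0])
next
  case (Suc j)
  have "top_pos (r * j + r) x = top_pos (r * j) x \<otimes>\<^bsub>top_grp\<^esub> top_pos r x"
    by (simp only: top_pos_add[OF x] funpow_mult_fixpoint[OF r])
  then show ?case
    by (simp only: Suc mult_Suc_right add.commute[of r] group.is_monoid[OF group_top, THEN monoid.nat_pow_Suc])
qed

text \<open>For a suitable multiple \<open>m\<close> of \<open>K * (q * q * q)\<close>, a walk of
  \<open>m\<close> steps restores both the point and the group element. The steps left over after
  \<open>t\<close> lead from \<open>(g', y)\<close> back to \<open>(g, x)\<close>, which gives the
  reverse inclusion.\<close>

lemma cls_eq:
  assumes g: "g \<in> carrier top_grp" and x: "x \<in> univ M" and mem: "(g', y) \<in> cls g x"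
  shows "cls g' y = cls g x"
proof -
  have monoid: "monoid top_grp" by (rule group.is_monoid[OF group_top])
  obtain t where t: "g' = g \<otimes>\<^bsub>top_grp\<^esub> top_pos t x" "y = (\<pi> ^^ t) x"
    using mem unfolding cls_def by blast
  have g': "g' \<in> carrier top_grp"
    unfolding t by (rule monoid.m_closed[OF monoid g top_pos_closed[OF x]])
  have y: "y \<in> univ M" unfolding t by (rule funpow_closed[OF x])
  define m where "m = K * (q * q * q * t)"
  have "top_pos m x = (top_pos K x [^]\<^bsub>top_grp\<^esub> (q * q * q)) [^]\<^bsub>top_grp\<^esub> t"
    unfolding m_def top_pos_mult[OF x period[OF x]] monoid.nat_pow_pow[OF monoid top_pos_closed[OF x]] ..
  also have "\<dots> = \<one>\<^bsub>top_grp\<^esub>"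
    unfolding top_exponent[OF top_pos_closed[OF x]] by (rule monoid.nat_pow_one[OF monoid])
  finally have pos_m: "top_pos m x = \<one>\<^bsub>top_grp\<^esub>" .
  have fix_m: "(\<pi> ^^ m) x = x" unfolding m_def by (rule funpow_mult_fixpoint[OF period[OF x]])
  have "1 * t \<le> K * (q * q * q) * t" using K q by (intro mult_right_mono) auto
  then obtain s where m: "m = t + s" unfolding m_def using le_Suc_ex by (metis mult_1 mult.assoc)
  have "g' \<otimes>\<^bsub>top_grp\<^esub> top_pos s y = g \<otimes>\<^bsub>top_grp\<^esub> top_pos m x"
    unfolding t m top_pos_add[OF x]
    by (rule monoid.m_assoc[OF monoid g top_pos_closed[OF x] top_pos_closed[OF funpow_closed[OF x]]])
  then have "g' \<otimes>\<^bsub>top_grp\<^esub> top_pos s y = g"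
    unfolding pos_m monoid.r_one[OF monoid g] .
  moreover have "(\<pi> ^^ s) y = x"
    using fix_m unfolding t m funpow_funpow add.commute[of s] .
  ultimately have "cls g x \<subseteq> cls g' y"
    using cls_subset[OF g' y, of s] by simp
  moreover have "cls g' y \<subseteq> cls g x" unfolding t by (rule cls_subset[OF g x])
  ultimately show ?thesis by blast
qed

lemma cls_one_eqD:
  assumes g: "g \<in> carrier top_grp" and x: "x \<in> univ M" and eq: "cls g x = cls \<one>\<^bsub>top_grp\<^esub> y"
  obtains t where "g \<otimes>\<^bsub>top_grp\<^esub> top_pos t x = \<one>\<^bsub>top_grp\<^esub>" and "y = (\<pi> ^^ t) x"
proof -
  have "(\<one>\<^bsub>top_grp\<^esub>, y) \<in> cls g x"
    unfolding eq by (rule cls_refl[OF monoid.one_closed[OF group.is_monoid[OF group_top]]])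
  then show thesis using that unfolding cls_def by fastforce
qed

text \<open>Two such points in one class are joined by a walk with trivial value; its projection to
  the base group is closed, and \<open>closed_walk\<close> brings it back to its start.\<close>

lemma inj_cls_one: "inj_on (cls \<one>\<^bsub>top_grp\<^esub>) (univ M)"
proof (rule inj_onI)
  fix x y assume x: "x \<in> univ M" and eq: "cls \<one>\<^bsub>top_grp\<^esub> x = cls \<one>\<^bsub>top_grp\<^esub> y"
  have monoid: "monoid top_grp" by (rule group.is_monoid[OF group_top])
  obtain t where t: "\<one>\<^bsub>top_grp\<^esub> \<otimes>\<^bsub>top_grp\<^esub> top_pos t x = \<one>\<^bsub>top_grp\<^esub>" "y = (\<pi> ^^ t) x"
    by (rule cls_one_eqD[OF monoid.one_closed[OF monoid] x eq])
  have "top_pos t x = \<one>\<^bsub>top_grp\<^esub>"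
    using t(1) unfolding monoid.l_one[OF monoid top_pos_closed[OF x]] .
  then have "pos t x = \<one>\<^bsub>base_grp\<^esub>"
    unfolding top_pos_eq[OF x] one_wreath[of base_grp] by simp
  then show "x = y" unfolding t(2) using closed_walk[OF x] by simp
qed

definition translate where
  "translate g B = (\<lambda>(h, x). (g \<otimes>\<^bsub>top_grp\<^esub> h, x)) ` (B :: (_ \<times> 'a) set)"

lemma translate_cls:
  assumes g: "g \<in> carrier top_grp" and h: "h \<in> carrier top_grp" and x: "x \<in> univ M"
  shows "translate g (cls h x) = cls (g \<otimes>\<^bsub>top_grp\<^esub> h) x"
proof -
  have "g \<otimes>\<^bsub>top_grp\<^esub> (h \<otimes>\<^bsub>top_grp\<^esub> top_pos t x) = g \<otimes>\<^bsub>top_grp\<^esub> h \<otimes>\<^bsub>top_grp\<^esub> top_pos t x" for t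
    by (rule monoid.m_assoc[OF group.is_monoid[OF group_top] g h top_pos_closed[OF x], symmetric])
  then show ?thesis
    unfolding translate_def cls_def image_image prod.case by (simp only:)
qed

text \<open>The points are the classes, the group acts by left multiplication, and
  \<open>rel_walks\<close> supplies the consistency that \<open>tournament_cover\<close>
  requires.\<close>

lemma extension:
  assumes fin: "finite (univ M)"
  shows "\<exists>M' :: ('a + nat) hypergraph.
    hypertournament L M' \<and> finite (univ M') \<and> substructure L (map_hypergraph Inl M) M' \<and>
    (\<forall>i\<in>I. \<exists>\<psi>. automorphism L M' \<psi> \<and> (\<forall>x\<in>univ M. lab x = i \<longrightarrow> \<psi> (Inl x) = Inl (\<pi> x)))"
proof -
  have monoid: "monoid top_grp" by (rule group.is_monoid[OF group_top])
  note one = monoid.one_closed[OF monoid]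
  let ?e = "cls \<one>\<^bsub>top_grp\<^esub>"
  define points where "points = (\<lambda>(g, x). cls g x) ` (carrier top_grp \<times> univ M)"
  have points: "cls g x \<in> points" if "g \<in> carrier top_grp" "x \<in> univ M" for g x
    using that unfolding points_def by force
  have pointsE: "\<exists>g x. B = cls g x \<and> g \<in> carrier top_grp \<and> x \<in> univ M" if "B \<in> points" for B
    using that unfolding points_def by force
  have "finite points" unfolding points_def using fin finite_top by (intro finite_imageI finite_cartesian_product)
  then obtain f :: "_ \<Rightarrow> nat" where f: "inj_on f points" using finite_imp_inj_to_nat_seg by blast
  \<comment> \<open>The class of \<open>(\<one>, x)\<close> is named \<open>Inl x\<close>, so that
    \<open>M\<close> lies in the extension exactly as its copy under \<open>Inl\<close>; all other
    classes get numbers.\<close>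
  define \<kappa> where "\<kappa> B = (if B \<in> ?e ` univ M then Inl (inv_into (univ M) ?e B) else Inr (f B))" for B
  have \<kappa>_e: "\<kappa> (?e x) = Inl x" if "x \<in> univ M" for x
    unfolding \<kappa>_def using that inv_into_f_f[OF inj_cls_one that] by simp
  have inj_\<kappa>: "inj_on \<kappa> points"
  proof (rule inj_onI)
    fix B C assume BC: "B \<in> points" "C \<in> points" and eq: "\<kappa> B = \<kappa> C"
    show "B = C"
    proof (cases "B \<in> ?e ` univ M")
      case True
      then have "C \<in> ?e ` univ M" "inv_into (univ M) ?e B = inv_into (univ M) ?e C"
        using eq unfolding \<kappa>_def by (simp_all split: if_splits)
      with True show ?thesis by (metis f_inv_into_f)
    next
      case False
      then have "f B = f C" using eq unfolding \<kappa>_def by (simp split: if_splits)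
      then show ?thesis by (rule inj_onD[OF f _ BC])
    qed
  qed
  define X where "X = \<kappa> ` points"
  define act where "act g y = \<kappa> (translate g (inv_into points \<kappa> y))" for g y
  have act: "act g (\<kappa> (cls h x)) = \<kappa> (cls (g \<otimes>\<^bsub>top_grp\<^esub> h) x)"
    if "g \<in> carrier top_grp" "h \<in> carrier top_grp" "x \<in> univ M" for g h x
    unfolding act_def inv_into_f_f[OF inj_\<kappa> points[OF that(2,3)]] translate_cls[OF that] ..
  have act_e: "act g (Inl x) = \<kappa> (cls g x)" if "g \<in> carrier top_grp" "x \<in> univ M" for g x
    using act[OF that(1) one that(2)] unfolding \<kappa>_e[OF that(2)] monoid.r_one[OF monoid that(1)] .
  have XE: "\<exists>g x. y = \<kappa> (cls g x) \<and> g \<in> carrier top_grp \<and> x \<in> univ M" if "y \<in> X" for y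
    using that pointsE unfolding X_def by blast
  have X: "\<kappa> (cls g x) \<in> X" if "g \<in> carrier top_grp" "x \<in> univ M" for g x
    unfolding X_def by (rule imageI, rule points[OF that])
  interpret cover: tournament_cover top_grp L M X act Inl "q * q * q"
  proof (rule tournament_cover.intro[OF group_top], rule tournament_cover_axioms.intro)
    fix l assume "l \<in> L"
    then show "prime l" by (rule prime_L)
    show "\<not> l dvd q * q * q"
      using coprime_q[OF \<open>l \<in> L\<close>] \<open>prime l\<close> by (simp add: prime_dvd_mult_iff)
  next
    show "hypertournament L M" by (rule tournament)
  next
    fix g y assume g: "g \<in> carrier top_grp" and "y \<in> X"
    then obtain h x where y: "y = \<kappa> (cls h x)" "h \<in> carrier top_grp" "x \<in> univ M" using XE by blast
    show "act g y \<in> X"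
      unfolding y(1) act[OF g y(2,3)] by (rule X[OF monoid.m_closed[OF monoid g y(2)] y(3)])
  next
    fix y assume "y \<in> X"
    then obtain h x where y: "y = \<kappa> (cls h x)" "h \<in> carrier top_grp" "x \<in> univ M" using XE by blast
    show "act \<one>\<^bsub>top_grp\<^esub> y = y"
      unfolding y(1) act[OF one y(2,3)] monoid.l_one[OF monoid y(2)] ..
  next
    fix g h y assume g: "g \<in> carrier top_grp" and h: "h \<in> carrier top_grp" and "y \<in> X"
    then obtain k x where y: "y = \<kappa> (cls k x)" "k \<in> carrier top_grp" "x \<in> univ M" using XE by blast
    show "act (g \<otimes>\<^bsub>top_grp\<^esub> h) y = act g (act h y)"
      unfolding y(1) act[OF h y(2,3)] act[OF g monoid.m_closed[OF monoid h y(2)] y(3)]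
        act[OF monoid.m_closed[OF monoid g h] y(2,3)] monoid.m_assoc[OF monoid g h y(2)] ..
  next
    fix g assume "g \<in> carrier top_grp"
    then show "g [^]\<^bsub>top_grp\<^esub> (q * q * q) = \<one>\<^bsub>top_grp\<^esub>" by (rule top_exponent)
  next
    show "Inl ` univ M \<subseteq> X"
    proof (rule image_subsetI)
      fix x assume "x \<in> univ M"
      then show "Inl x \<in> X" using X[OF one] \<kappa>_e by metis
    qed
  next
    show "inj_on (Inl :: 'a \<Rightarrow> 'a + nat) (univ M)" by simp
  next
    fix g xs f
    assume g: "g \<in> carrier top_grp" and len: "length xs \<in> L"
      and f: "\<And>x. x \<in> set xs \<Longrightarrow> x \<in> univ M \<and> f x \<in> univ M \<and> act g (Inl x) = Inl (f x)"
    \<comment> \<open>If \<open>g\<close> sends copies of points of \<open>M\<close> to such copies,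
      it does so along walks that all have the value \<open>inv g\<close>, which is the situation of
      \<open>rel_walks\<close>.\<close>
    have "\<exists>t. top_pos t x = inv\<^bsub>top_grp\<^esub> g \<and> f x = (\<pi> ^^ t) x" if x: "x \<in> set xs" for x
    proof -
      have xM: "x \<in> univ M" and fM: "f x \<in> univ M" and "act g (Inl x) = Inl (f x)"
        using f[OF x] by simp_all
      then have "\<kappa> (cls g x) = \<kappa> (?e (f x))"
        unfolding act_e[OF g xM] \<kappa>_e[OF fM] by simp
      then have "cls g x = ?e (f x)"
        by (rule inj_onD[OF inj_\<kappa> _ points[OF g xM] points[OF one fM]])
      then obtain t where t: "g \<otimes>\<^bsub>top_grp\<^esub> top_pos t x = \<one>\<^bsub>top_grp\<^esub>" "f x = (\<pi> ^^ t) x"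
        by (rule cls_one_eqD[OF g xM])
      have "inv\<^bsub>top_grp\<^esub> g = top_pos t x"
        by (rule group.inv_equality[OF group_top _ g top_pos_closed[OF xM]])
          (rule group.inv_comm[OF group_top t(1) g top_pos_closed[OF xM]])
      then show ?thesis using t(2) by metis
    qed
    then obtain t where t: "\<And>x. x \<in> set xs \<Longrightarrow> top_pos (t x) x = inv\<^bsub>top_grp\<^esub> g \<and> f x = (\<pi> ^^ t x) x"
      by metis
    have "xs \<in> rel M (length xs) \<longleftrightarrow> map (\<lambda>x. (\<pi> ^^ t x) x) xs \<in> rel M (length xs)"
    proof (rule rel_walks[OF len])
      show "set xs \<subseteq> univ M" using f by blast
    next
      fix x assume "x \<in> set xs"
      from t[OF this] show "top_pos (t x) x = inv\<^bsub>top_grp\<^esub> g" by (rule conjunct1)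
    qed
    moreover have "map f xs = map (\<lambda>x. (\<pi> ^^ t x) x) xs"
      using t by (intro map_cong refl) simp
    ultimately show "xs \<in> rel M (length xs) \<longleftrightarrow> map f xs \<in> rel M (length xs)" by (simp only:)
  qed
  have "\<exists>\<psi>. automorphism L cover.cover \<psi> \<and> (\<forall>x\<in>univ M. lab x = i \<longrightarrow> \<psi> (Inl x) = Inl (\<pi> x))" if i: "i \<in> I" for i
  proof -
    have gen: "top_gen i \<in> carrier top_grp" using top_gen i by blast
    \<comment> \<open>The class of \<open>(\<one>, x)\<close> contains
      \<open>(top_gen i, \<pi> x)\<close> when \<open>x\<close> is labelled \<open>i\<close>, so it
      is the inverse of the generator that moves \<open>x\<close> to \<open>\<pi> x\<close>.\<close>
    define g where "g = inv\<^bsub>top_grp\<^esub> top_gen i"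
    have g: "g \<in> carrier top_grp" unfolding g_def by (rule group.inv_closed[OF group_top gen])
    have "act g (Inl x) = Inl (\<pi> x)" if x: "x \<in> univ M" and lab: "lab x = i" for x
    proof -
      have "path_word 1 x = [] @ [i]" by (simp add: path_word_def lab)
      then have "top_pos 1 x = top_gen i"
        by (simp only: top_pos_def word_prod_snoc word_prod_Nil monoid.l_one[OF monoid gen])
      then have "g \<otimes>\<^bsub>top_grp\<^esub> top_pos 1 x = \<one>\<^bsub>top_grp\<^esub>"
        by (simp only: g_def group.l_inv[OF group_top gen])
      moreover have step: "(\<pi> ^^ 1) x = \<pi> x" by simp
      ultimately have "(\<one>\<^bsub>top_grp\<^esub>, \<pi> x) = (g \<otimes>\<^bsub>top_grp\<^esub> top_pos 1 x, (\<pi> ^^ 1) x)"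
        by (simp only:)
      then have "(\<one>\<^bsub>top_grp\<^esub>, \<pi> x) \<in> cls g x" unfolding cls_def by (rule range_eqI)
      then have "?e (\<pi> x) = cls g x" by (rule cls_eq[OF g x])
      moreover have "\<pi> x \<in> univ M" using funpow_closed[OF x, of 1] unfolding step .
      ultimately show ?thesis
        unfolding act_e[OF g x] using \<kappa>_e by metis
    qed
    then show ?thesis using cover.automorphism_act[OF g] by blast
  qed
  moreover have "finite X" unfolding X_def using \<open>finite points\<close> by (rule finite_imageI)
  then have "finite (univ cover.cover)" unfolding cover.univ_cover .
  ultimately show ?thesis
    using cover.hypertournament_cover cover.substructure_cover by blast
qed

end

section \<open>Reduction to a labelled permutation\<close>

text \<open>All prime factors from \<open>L\<close> are moved into \<open>k\<close>, so that
  \<open>a\<close> can become a factor of the modulus.\<close>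

lemma split_off_primes:
  fixes K :: nat
  assumes "\<forall>l\<in>L. prime l" and "0 < K"
  shows "\<exists>a k. K = a * k \<and> (\<forall>l\<in>L. \<not> l dvd a) \<and> (\<forall>r. prime r \<longrightarrow> r dvd k \<longrightarrow> r \<in> L)"
  using assms(2)
proof (induction K rule: less_induct)
  case (less K)
  show ?case
  proof (cases "\<exists>l\<in>L. l dvd K")
    case True
    then obtain l where l: "l \<in> L" "l dvd K" by blast
    from l(2) obtain m where K: "K = l * m" by (rule dvdE)
    have "prime l" using assms(1) l(1) by blast
    then have "m < K" "0 < m" using K less.prems prime_gt_1_nat[of l] by auto
    then obtain a k where a: "m = a * k" "\<forall>l\<in>L. \<not> l dvd a" "\<forall>r. prime r \<longrightarrow> r dvd k \<longrightarrow> r \<in> L"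
      using less.IH by blast
    have "r \<in> L" if r: "prime r" "r dvd l * k" for r
    proof -
      have "r dvd l \<or> r dvd k" using r by (simp add: prime_dvd_mult_iff)
      then show ?thesis
        using a(3) r(1) l(1) primes_dvd_imp_eq[OF r(1) \<open>prime l\<close>] by blast
    qed
    moreover have "K = a * (l * k)" by (simp add: K a(1))
    ultimately show ?thesis using a(2) by blast
  next
    case False
    have "K = K * 1" by simp
    moreover have "\<forall>r::nat. prime r \<longrightarrow> r dvd 1 \<longrightarrow> r \<in> L" by simp
    ultimately show ?thesis using False by blast
  qed
qed

text \<open>If \<open>x\<close> lies outside \<open>D\<close>, its colour class has more points than
  \<open>g\<close> uses up, because \<open>g\<close> is injective and keeps colours. So a value of
  the right colour is still free for \<open>x\<close>.\<close>

lemma extend_to_permutation: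
  assumes "finite M" and "D \<subseteq> M" and "inj_on g D" and "g ` D \<subseteq> M"
    and "\<And>x. x \<in> D \<Longrightarrow> col (g x) = col x"
  shows "\<exists>\<pi>. \<pi> permutes M \<and> (\<forall>x\<in>D. \<pi> x = g x) \<and> (\<forall>x\<in>M. col (\<pi> x) = col x)"
  using assms(2-)
proof (induction "card (M - D)" arbitrary: D g)
  case 0
  then have D: "D = M" using assms(1) by auto
  define \<pi> where "\<pi> x = (if x \<in> M then g x else x)" for x
  have "g ` M = M"
    using 0 D assms(1) by (metis card_image card_subset_eq)
  then have "bij_betw g M M" using 0 D by (simp add: bij_betw_def)
  then have "bij_betw \<pi> M M" by (subst bij_betw_cong[of _ _ g]) (simp_all add: \<pi>_def)
  then have "\<pi> permutes M" by (rule bij_imp_permutes) (simp add: \<pi>_def)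
  moreover have "\<forall>x\<in>D. \<pi> x = g x" and "\<forall>x\<in>M. col (\<pi> x) = col x"
    using 0 by (simp_all add: \<pi>_def D)
  ultimately show ?case by blast
next
  case (Suc m)
  then have "M - D \<noteq> {}" by (metis card.empty nat.distinct(1))
  then obtain x where x: "x \<in> M" "x \<notin> D" by blast
  let ?C = "{y. col y = col x}"
  have fin: "finite D" using Suc.prems(1) assms(1) by (rule finite_subset)
  have "g ` D \<inter> ?C = g ` (D \<inter> ?C)" using Suc.prems(4) by auto
  then have "card (g ` D \<inter> ?C) = card (D \<inter> ?C)"
    using Suc.prems(2) by (metis card_image inf_le1 inj_on_subset)
  also have "\<dots> < card (M \<inter> ?C)"
    using x Suc.prems(1) assms(1) by (intro psubset_card_mono) auto
  finally have "\<not> M \<inter> ?C \<subseteq> g ` D \<inter> ?C"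
    using fin by (metis card_mono finite_Int finite_imageI not_less)
  then obtain y where y: "y \<in> M" "col y = col x" "y \<notin> g ` D" by blast
  have "\<exists>\<pi>. \<pi> permutes M \<and> (\<forall>z\<in>insert x D. \<pi> z = (g(x := y)) z) \<and> (\<forall>z\<in>M. col (\<pi> z) = col z)"
  proof (rule Suc.hyps(1))
    have "M - D = insert x (M - insert x D)" using x by blast
    then have "card (M - D) = Suc (card (M - insert x D))"
      using assms(1) by (metis Diff_iff card_insert_disjoint finite_Diff insertI1)
    then show "m = card (M - insert x D)" using Suc.hyps(2) by simp
    show "inj_on (g(x := y)) (insert x D)"
      using Suc.prems(2) x y by (auto simp: inj_on_def)
  qed (use x y Suc.prems in \<open>auto split: if_splits\<close>)
  then show ?case using x(2) by (metis fun_upd_other insertI2)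
qed

theorem theorem1p2:
  fixes L :: "nat set"
    and M :: "'a hypergraph"
    and n :: nat
    and \<phi> :: "nat \<Rightarrow> 'a \<rightharpoonup> 'a"
  assumes "\<forall>l\<in>L. prime l"
    and "\<exists>p. prime p \<and> p \<notin> L"
    and "hypertournament L M"
    and "finite (univ M)"
    and "\<forall>i\<in>{1..n}. partial_automorphism L M (\<phi> i)"
    and "disjoint_family_on (\<lambda>i. dom (\<phi> i)) {1..n}"
    and "disjoint_family_on (\<lambda>i. ran (\<phi> i)) {1..n}"
  shows "\<exists>M' :: ('a + nat) hypergraph.
    hypertournament L M' \<and> finite (univ M') \<and>
    substructure L (map_hypergraph Inl M) M' \<and>
    (\<forall>i\<in>{1..n}. \<exists>\<psi>. automorphism L M' \<psi> \<and>
      (\<forall>x y. \<phi> i x = Some y \<longrightarrow> \<psi> (Inl x) = Inl y))"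
proof -
  obtain p where p: "prime p" "p \<notin> L" using assms(2) by blast
  define D where "D = (\<Union>i\<in>{1..n}. dom (\<phi> i))"
  define idx where "idx x = (SOME i. i \<in> {1..n} \<and> x \<in> dom (\<phi> i))" for x
  define g where "g x = the (\<phi> (idx x) x)" for x
  \<comment> \<open>the colour of \<open>x\<close> is what the one-point maps must preserve\<close>
  define col where "col x = {l \<in> L. replicate l x \<in> rel M l}" for x
  have dom_ran: "dom (\<phi> i) \<subseteq> univ M" "ran (\<phi> i) \<subseteq> univ M"
    and inj: "inj_on (the \<circ> \<phi> i) (dom (\<phi> i))"
    and iso: "\<And>xs. length xs \<in> L \<Longrightarrow> set xs \<subseteq> dom (\<phi> i) \<Longrightarrow>
      xs \<in> rel M (length xs) \<longleftrightarrow> map (the \<circ> \<phi> i) xs \<in> rel M (length xs)"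
    if i: "i \<in> {1..n}" for i
  proof -
    have *: "partial_automorphism L M (\<phi> i)" using assms(5) i by blast
    then show "dom (\<phi> i) \<subseteq> univ M" "ran (\<phi> i) \<subseteq> univ M" "inj_on (the \<circ> \<phi> i) (dom (\<phi> i))"
      by (auto simp: partial_automorphism_def Defs.is_iso_def induced_def bij_betw_def)
    fix xs assume xs: "length xs \<in> L" "set xs \<subseteq> dom (\<phi> i)"
    have "set (map (the \<circ> \<phi> i) xs) \<subseteq> ran (\<phi> i)"
      using xs(2) by (auto simp: ran_def subset_iff dom_def)
    moreover have "xs \<in> {xs \<in> rel M (length xs). set xs \<subseteq> dom (\<phi> i)} \<longleftrightarrow>
        map (the \<circ> \<phi> i) xs \<in> {ys \<in> rel M (length xs). set ys \<subseteq> ran (\<phi> i)}"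
      using * xs unfolding partial_automorphism_def Defs.is_iso_def induced_def by auto
    ultimately show "xs \<in> rel M (length xs) \<longleftrightarrow> map (the \<circ> \<phi> i) xs \<in> rel M (length xs)"
      using xs(2) by blast
  qed
  have idx: "idx x = i" if "i \<in> {1..n}" "x \<in> dom (\<phi> i)" for i x
  proof -
    have "idx x \<in> {1..n} \<and> x \<in> dom (\<phi> (idx x))"
      unfolding idx_def using that by (rule someI[of _ i, OF conjI])
    then show ?thesis using assms(6) that unfolding disjoint_family_on_def by blast
  qed
  have g: "g x = the (\<phi> i x)" if "i \<in> {1..n}" "x \<in> dom (\<phi> i)" for i x
    using idx[OF that] by (simp add: g_def)
  have g_ran: "g x \<in> ran (\<phi> i)" if "i \<in> {1..n}" "x \<in> dom (\<phi> i)" for i x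
    using g[OF that] that(2) by (auto intro: ranI)
  have "D \<subseteq> univ M" unfolding D_def using dom_ran by blast
  moreover have "inj_on g D"
  proof (rule inj_onI)
    fix x y assume "x \<in> D" "y \<in> D" and eq: "g x = g y"
    then obtain i j where i: "i \<in> {1..n}" "x \<in> dom (\<phi> i)" and j: "j \<in> {1..n}" "y \<in> dom (\<phi> j)"
      unfolding D_def by blast
    have "i = j"
      using assms(7) i(1) j(1) g_ran[OF i] g_ran[OF j] eq unfolding disjoint_family_on_def by fastforce
    then show "x = y"
      using inj_onD[OF inj[OF i(1)], of x y] i j eq g by simp
  qed
  moreover have "g ` D \<subseteq> univ M" unfolding D_def using g_ran dom_ran by blast
  moreover have "col (g x) = col x" if x: "x \<in> D" for x
  proof -
    obtain i where i: "i \<in> {1..n}" "x \<in> dom (\<phi> i)" using x unfolding D_def by blast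
    have "replicate l x \<in> rel M l \<longleftrightarrow> replicate l (g x) \<in> rel M l" if "l \<in> L" for l
    proof -
      have "set (replicate l x) \<subseteq> dom (\<phi> i)" using i(2) by (simp add: set_replicate_conv_if)
      then show ?thesis
        using iso[OF i(1), of "replicate l x"] that g[OF i] by (simp add: map_replicate)
    qed
    then show ?thesis unfolding col_def by blast
  qed
  ultimately obtain \<pi> where \<pi>: "\<pi> permutes univ M" "\<And>x. x \<in> D \<Longrightarrow> \<pi> x = g x"
    "\<And>x. x \<in> univ M \<Longrightarrow> col (\<pi> x) = col x"
    using extend_to_permutation[OF assms(4), of D g col] by blast
  \<comment> \<open>Each point outside \<open>D\<close> has a label of its own, so it is moved by a
    one-point map.\<close>
  define lab :: "'a \<Rightarrow> nat + 'a" where "lab x = (if x \<in> D then Inl (idx x) else Inr x)" for x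
  \<comment> \<open>All indices are included, because an empty \<open>\<phi> i\<close> labels no
    point but still has to receive an automorphism.\<close>
  define I where "I = lab ` univ M \<union> Inl ` {1..n}"
  have "permutation \<pi>" using \<pi>(1) assms(4) permutation_permutes by blast
  then obtain K where K: "\<pi> ^^ K = id" "0 < K" by (rule permutation_is_nilpotent)
  obtain a k where a: "K = a * k" "\<forall>l\<in>L. \<not> l dvd a" "\<forall>r. prime r \<longrightarrow> r dvd k \<longrightarrow> r \<in> L"
    using split_off_primes[OF assms(1) K(2)] by blast
  have pos: "0 < a" "0 < k" using a(1) K(2) by auto
  \<comment> \<open>The prime \<open>p\<close> is outside \<open>L\<close>, and the exponent
    \<open>K\<close> gives \<open>K < p ^ K\<close>; the factor \<open>a\<close> makes
    \<open>K = a * k\<close> divide \<open>q * k\<close>.\<close>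
  define q where "q = a * p ^ K"
  have "K < p ^ K" using prime_gt_1_nat[OF p(1)] by (intro power_gt_expt) simp
  moreover have "p ^ K \<le> q" using pos(1) by (simp add: q_def)
  ultimately have q: "K < q" by simp
  interpret labelled_tournament_period L M \<pi> lab I q K k
  proof unfold_locales
    fix xs i assume len: "length xs \<in> L" and xs: "set xs \<subseteq> univ M" and i: "\<And>x. x \<in> set xs \<Longrightarrow> lab x = i"
    have "xs \<noteq> []" using assms(1) len by force
    then obtain x where x: "x \<in> set xs" by (metis list.set_intros(1) neq_Nil_conv)
    show "xs \<in> rel M (length xs) \<longleftrightarrow> map \<pi> xs \<in> rel M (length xs)"
    proof (cases "x \<in> D")
      case True
      then obtain j where j: "j \<in> {1..n}" "x \<in> dom (\<phi> j)" unfolding D_def by blast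
      have y: "y \<in> dom (\<phi> j)" if y: "y \<in> set xs" for y
      proof -
        have "lab y = Inl j" using i[OF x] i[OF y] True idx[OF j] by (simp add: lab_def)
        then have "y \<in> D" "idx y = j" by (simp_all add: lab_def split: if_splits)
        then show ?thesis using idx unfolding D_def by blast
      qed
      then have "\<pi> y = (the \<circ> \<phi> j) y" if "y \<in> set xs" for y
        using \<pi>(2)[of y] g[OF j(1) y[OF that]] that j(1) unfolding D_def by fastforce
      then have "map \<pi> xs = map (the \<circ> \<phi> j) xs" by (rule map_cong[OF refl])
      then show ?thesis using iso[OF j(1) len] y by (simp only:) blast
    next
      case False
      have "y = x" if "y \<in> set xs" for y
      proof -
        have "lab y = Inr x" using i[OF that] i[OF x] False by (simp add: lab_def)
        then show ?thesis by (simp add: lab_def split: if_splits)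
      qed
      \<comment> \<open>Only constant tuples carry the label of a point outside \<open>D\<close>;
        whether they are related is recorded by the colour, which \<open>\<pi>\<close>
        preserves.\<close>
      then have "xs = replicate (length xs) x" by (simp add: replicate_eqI)
      then obtain l where l: "xs = replicate l x" by blast
      have "x \<in> univ M" using x xs by blast
      then have "col (\<pi> x) = col x" by (rule \<pi>(3))
      then show ?thesis using len unfolding l col_def by (auto simp: map_replicate)
    qed
  next
    fix l assume l: "l \<in> L"
    then have "prime l" "\<not> l dvd a" using assms(1) a(2) by blast+
    moreover have "\<not> l dvd p ^ K"
      using l p \<open>prime l\<close> by (metis prime_dvd_power primes_dvd_imp_eq)
    ultimately show "\<not> l dvd q" unfolding q_def by (simp add: prime_dvd_mult_iff)
  next
    show "K dvd q * k" unfolding a(1) q_def by simp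
  next
    show "finite I" using assms(4) by (simp add: I_def)
  next
    fix r assume "prime r" "r dvd k"
    then show "r \<in> L" using a(3) by blast
  qed (use assms(1,3) \<pi>(1) K q pos in \<open>auto simp: I_def\<close>)
  obtain M' :: "('a + nat) hypergraph" where M': "hypertournament L M'" "finite (univ M')"
    "substructure L (map_hypergraph Inl M) M'"
    "\<And>i. i \<in> I \<Longrightarrow> \<exists>\<psi>. automorphism L M' \<psi> \<and> (\<forall>x\<in>univ M. lab x = i \<longrightarrow> \<psi> (Inl x) = Inl (\<pi> x))"
    using extension[OF assms(4)] by blast
  have "\<exists>\<psi>. automorphism L M' \<psi> \<and> (\<forall>x y. \<phi> i x = Some y \<longrightarrow> \<psi> (Inl x) = Inl y)" if i: "i \<in> {1..n}" for i
  proof -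
    have "Inl i \<in> I" using i by (simp add: I_def)
    then obtain \<psi> where \<psi>: "automorphism L M' \<psi>" "\<forall>x\<in>univ M. lab x = Inl i \<longrightarrow> \<psi> (Inl x) = Inl (\<pi> x)"
      using M'(4) by blast
    have "\<psi> (Inl x) = Inl y" if xy: "\<phi> i x = Some y" for x y
    proof -
      have x: "x \<in> dom (\<phi> i)" using xy by blast
      then have "x \<in> D" "x \<in> univ M" using i dom_ran(1)[OF i] unfolding D_def by blast+
      then show ?thesis
        using \<psi>(2) \<pi>(2) g[OF i x] idx[OF i x] xy by (simp add: lab_def)
    qed
    with \<psi>(1) show ?thesis by blast
  qed
  with M'(1-3) show ?thesis by blast
qed

end
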